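(* Let $S\subseteq\mathbb{Z}^n$ be the set of integral points in some rational polyhedron of $\mathbb{R}^n$ such that $\dim(S)=n$, and let $f\in\mathrm{conv}(S)\setminus\mathbb{Z}^n$. For every minimal valid function $\psi:\mathbb{R}^n\to\mathbb{R}$ (with respect to $f$ and $S$), there exists a maximal $S$-free convex set $B$ with $f$ in its interior such that $\psi_B$ dominates $\psi$. Furthermore, if $B$ is a maximal $S$-free convex set containing $f$ in its interior, then $\psi_B$ is a minimal valid function (with respect to $f$ and $S$).
   Context: A polyhedron is rational if it can be written as $\{x : Ax\le b\}$ with finitely many inequalities and $A$, $b$ rational. $\dim(S)=n$ means that $S$ contains $n+1$ affinely independent points. An $S$-free convex set is a convex set in $\mathbb{R}^n$ containing no point of $S$ in its interior; it is maximal if it is not properly contained in any $S$-free convex set. Let $R_{f,S}$ be the set of all vectors $s=(s_r)_{r\in\mathbb{R}^n}$ of real numbers with finite support (i.e. $s_r=0$ for all but finitely many $r\in\mathbb{R}^n$) such that $s_r\ge 0$ for all $r\in\mathbb{R}^n$ and $f+\sum_{r\in\mathbb{R}^n} r s_r\in S$. A function $\psi:\mathbb{R}^n\to\mathbb{R}$ is valid (with respect to $f$ and $S$) if $\sum_{r\in\mathbb{R}^n}\psi(r)s_r\ge 1$ for every $s\in R_{f,S}$. A function $\psi'$ dominates a function $\psi$ if $\psi'(r)\le\psi(r)$ for all $r\in\mathbb{R}^n$. A valid function $\psi$ is minimal if there is no valid function $\psi'\ne\psi$ that dominates $\psi$. Every maximal $S$-free convex set $B\subseteq\mathbb{R}^n$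 containing $f$ in its interior is a polyhedron and can be uniquely written (taking one inequality per facet) in the form $B=\{x\in\mathbb{R}^n : a_i(x-f)\le 1,\ i=1,\ldots,k\}$ with $a_i\in\mathbb{R}^n$, where $a_i(x-f)$ is the scalar product. For such $B$ the function $\psi_B:\mathbb{R}^n\to\mathbb{R}$ is defined by $\psi_B(r)=\max_{i=1,\ldots,k} a_i r$. *)

theory Defs
  imports "HOL-Analysis.Analysis"
begin

definition integer_points :: "(real ^ 'n) set" where
  "integer_points = {x. \<forall>i. x $ i \<in> \<int>}"

text \<open>A finite system \<open>A x \<le> b\<close> is represented by the finite set of its rows \<open>(a, b)\<close>.\<close>

definition rational_polyhedron :: "(real ^ 'n) set \<Rightarrow> bool" where
  "rational_polyhedron P \<longleftrightarrow>
     (\<exists>I :: ((real ^ 'n) \<times> real) set. finite I \<and>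
        (\<forall>(a, b) \<in> I. (\<forall>i. a $ i \<in> \<rat>) \<and> b \<in> \<rat>) \<and>
        P = {x. \<forall>(a, b) \<in> I. a \<bullet> x \<le> b})"

definition full_dimensional :: "(real ^ 'n) set \<Rightarrow> bool" where
  "full_dimensional S \<longleftrightarrow>
     (\<exists>T. T \<subseteq> S \<and> finite T \<and> card T = CARD('n) + 1 \<and> \<not> affine_dependent T)"

definition S_free_convex :: "(real ^ 'n) set \<Rightarrow> (real ^ 'n) set \<Rightarrow> bool" where
  "S_free_convex S B \<longleftrightarrow> convex B \<and> interior B \<inter> S = {}"

definition maximal_S_free_convex :: "(real ^ 'n) set \<Rightarrow> (real ^ 'n) set \<Rightarrow> bool" where
  "maximal_S_free_convex S B \<longleftrightarrow>
     S_free_convex S B \<and> \<not> (\<exists>C. S_free_convex S C \<and> B \<subset> C)"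

text \<open>The set \<open>R\<^sub>f\<^sub>,\<^sub>S\<close>; sums over all of \<open>\<real>\<^sup>n\<close> are taken over the finite support.\<close>

definition feasible :: "real ^ 'n \<Rightarrow> (real ^ 'n) set \<Rightarrow> (real ^ 'n \<Rightarrow> real) set" where
  "feasible f S =
     {s. finite {r. s r \<noteq> 0} \<and> (\<forall>r. 0 \<le> s r) \<and>
         f + (\<Sum>r | s r \<noteq> 0. s r *\<^sub>R r) \<in> S}"

definition valid_fun :: "real ^ 'n \<Rightarrow> (real ^ 'n) set \<Rightarrow> (real ^ 'n \<Rightarrow> real) \<Rightarrow> bool" where
  "valid_fun f S \<psi> \<longleftrightarrow> (\<forall>s \<in> feasible f S. (\<Sum>r | s r \<noteq> 0. \<psi> r * s r) \<ge> 1)"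

definition dominates :: "(real ^ 'n \<Rightarrow> real) \<Rightarrow> (real ^ 'n \<Rightarrow> real) \<Rightarrow> bool" where
  "dominates \<psi>' \<psi> \<longleftrightarrow> (\<forall>r. \<psi>' r \<le> \<psi> r)"

definition minimal_valid_fun ::
    "real ^ 'n \<Rightarrow> (real ^ 'n) set \<Rightarrow> (real ^ 'n \<Rightarrow> real) \<Rightarrow> bool" where
  "minimal_valid_fun f S \<psi> \<longleftrightarrow>
     valid_fun f S \<psi> \<and> \<not> (\<exists>\<psi>'. valid_fun f S \<psi>' \<and> \<psi>' \<noteq> \<psi> \<and> dominates \<psi>' \<psi>)"

text \<open>\<open>A\<close> is the set of coefficient vectors \<open>a\<^sub>i\<close> of a description
  \<open>B = {x. a\<^sub>i \<bullet> (x - f) \<le> 1 for all i}\<close> with exactly one inequality per facet of \<open>B\<close>.\<close>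

definition facet_description :: "real ^ 'n \<Rightarrow> (real ^ 'n) set \<Rightarrow> (real ^ 'n) set \<Rightarrow> bool" where
  "facet_description f B A \<longleftrightarrow>
     finite A \<and> B = {x. \<forall>a \<in> A. a \<bullet> (x - f) \<le> 1} \<and>
     bij_betw (\<lambda>a. {x \<in> B. a \<bullet> (x - f) = 1}) A {F. F facet_of B}"

text \<open>Every polyhedron with \<open>f\<close> in its interior has exactly one such description
  (\<open>facet_description_ex1\<close> below), so the definite description is meaningful there.
  If \<open>B\<close> is moreover not the whole space, \<open>A\<close> is nonempty and so the maximum is
  over a nonempty finite set.\<close>

definition facet_normals :: "real ^ 'n \<Rightarrow> (real ^ 'n) set \<Rightarrow> (real ^ 'n) set" where
  "facet_normals f B = (THE A. facet_description f B A)"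

definition psi :: "real ^ 'n \<Rightarrow> (real ^ 'n) set \<Rightarrow> real ^ 'n \<Rightarrow> real" where
  "psi f B r = Max ((\<lambda>a. a \<bullet> r) ` facet_normals f B)"

lemma facet_normal_unique:
  fixes f a a' :: "real ^ 'n"
  assumes f: "f \<in> interior B"
    and F: "{x \<in> B. a \<bullet> (x - f) = 1} facet_of B"
    and eq: "{x \<in> B. a \<bullet> (x - f) = 1} = {x \<in> B. a' \<bullet> (x - f) = 1}"
  shows "a = a'"
proof -
  let ?F = "{x \<in> B. a \<bullet> (x - f) = 1}"
  define H where "H c = {x. c \<bullet> x = 1 + c \<bullet> f}" for c :: "real ^ 'n"
  have dimB: "aff_dim B = int CARD('n)"
    using f aff_dim_nonempty_interior[of B] by auto
  have neF: "?F \<noteq> {}" and dimF: "aff_dim ?F = int CARD('n) - 1"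
    using F dimB by (auto simp: facet_of_def)
  have hull: "affine hull ?F = H c" if c: "?F = {x \<in> B. c \<bullet> (x - f) = 1}" for c
  proof (rule affine_dim_equal)
    have c0: "c \<noteq> 0" using c neF by auto
    show "affine (H c)" unfolding H_def by (rule affine_hyperplane)
    then show "affine hull ?F \<subseteq> H c"
      using c by (intro hull_minimal) (auto simp: H_def inner_diff_right)
    show "aff_dim (affine hull ?F) = aff_dim (H c)"
      using dimF c0 by (simp add: H_def aff_dim_affine_hull)
  qed (use neF in auto)
  have H: "a' \<bullet> (x - f) = 1" if "a \<bullet> (x - f) = 1" for x
  proof -
    have "x \<in> H a" using that by (simp add: H_def inner_diff_right)
    then have "x \<in> H a'" using hull[OF refl] hull[OF eq] by simp
    then show ?thesis by (simp add: H_def inner_diff_right)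
  qed
  have a0: "a \<bullet> a \<noteq> 0" using neF by auto
  define u where "u = (1 / (a \<bullet> a)) *\<^sub>R a"
  have au: "a \<bullet> u = 1" using a0 by (simp add: u_def)
  then have a'u: "a' \<bullet> u = 1" using H[of "f + u"] by simp
  define y where "y = a' - a"
  have y1: "y \<bullet> u = 0" using au a'u by (simp add: y_def inner_diff_left)
  then have ya: "a \<bullet> y = 0" using a0 by (simp add: u_def inner_commute)
  then have "a' \<bullet> y = 0" using H[of "f + u + y"] au a'u by (simp add: inner_add_right add.assoc)
  then have "y \<bullet> y = 0" using ya by (simp add: y_def inner_diff_left)
  then show ?thesis by (simp add: y_def)
qed

lemma facet_description_unique:
  fixes f :: "real ^ 'n"
  assumes f: "f \<in> interior B" and A: "facet_description f B A" and A': "facet_description f B A'"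
  shows "A = A'"
proof -
  have "C \<subseteq> C'" if C: "facet_description f B C" and C': "facet_description f B C'" for C C'
  proof
    fix a assume a: "a \<in> C"
    let ?F = "\<lambda>a. {x \<in> B. a \<bullet> (x - f) = 1}"
    have im: "?F ` C = {F. F facet_of B}" "?F ` C' = {F. F facet_of B}"
      using C C' unfolding facet_description_def by (elim conjE bij_betw_imp_surj_on)+
    have "?F a \<in> ?F ` C" using a by (rule imageI)
    then have Fa: "?F a facet_of B" and "?F a \<in> ?F ` C'" unfolding im by simp_all
    then obtain a' where a': "a' \<in> C'" and eq: "?F a = ?F a'" by (elim imageE)
    have "a = a'" by (rule facet_normal_unique[OF f Fa eq])
    then show "a \<in> C'" using a' by simp
  qed
  from this[OF A A'] this[OF A' A] show ?thesis by (rule subset_antisym)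
qed

lemma facet_description_ex1:
  fixes f :: "real ^ 'n"
  assumes B: "polyhedron B" and f: "f \<in> interior B"
  shows "\<exists>!A. facet_description f B A"
proof -
  have aff: "affine hull B = UNIV"
    using f affine_hull_nonempty_interior[of B] by auto
  obtain \<F> where fin: "finite \<F>" and seq: "B = affine hull B \<inter> \<Inter>\<F>"
    and hs: "\<forall>h\<in>\<F>. \<exists>a b. a \<noteq> 0 \<and> h = {x. a \<bullet> x \<le> b}"
    and min: "\<And>F'. F' \<subset> \<F> \<Longrightarrow> B \<subset> affine hull B \<inter> \<Inter>F'"
    using B unfolding polyhedron_Int_affine_minimal by blast
  obtain a b where ab: "\<And>h. h \<in> \<F> \<Longrightarrow> a h \<noteq> 0 \<and> h = {x. a h \<bullet> x \<le> b h}"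
    using hs by metis
  have facet: "C facet_of B \<longleftrightarrow> (\<exists>h. h \<in> \<F> \<and> C = B \<inter> {x. a h \<bullet> x = b h})" for C
    by (rule facet_of_polyhedron_explicit[OF fin seq ab min])
  have pos: "a h \<bullet> f < b h" if h: "h \<in> \<F>" for h
  proof -
    have "B \<subseteq> h" using seq h by blast
    then have "f \<in> interior h" using f interior_mono by blast
    moreover have "interior h = {x. a h \<bullet> x < b h}"
      using ab[OF h] interior_halfspace_le by metis
    ultimately show ?thesis by blast
  qed
  define d where "d h = (1 / (b h - a h \<bullet> f)) *\<^sub>R a h" for h
  have d: "d h \<bullet> (x - f) = (a h \<bullet> x - a h \<bullet> f) / (b h - a h \<bullet> f)" for h x
    by (simp add: d_def inner_diff_right diff_divide_distrib)
  have le: "d h \<bullet> (x - f) \<le> 1 \<longleftrightarrow> x \<in> h" and eq: "d h \<bullet> (x - f) = 1 \<longleftrightarrow> a h \<bullet> x = b h"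
    if h: "h \<in> \<F>" for h x
  proof -
    have "d h \<bullet> (x - f) \<le> 1 \<longleftrightarrow> a h \<bullet> x \<le> b h" 
      unfolding d using pos[OF h] by (simp add: divide_le_eq)
    also have "\<dots> \<longleftrightarrow> x \<in> h" using ab[OF h] by blast
    finally show "d h \<bullet> (x - f) \<le> 1 \<longleftrightarrow> x \<in> h" .
    show "d h \<bullet> (x - f) = 1 \<longleftrightarrow> a h \<bullet> x = b h"
      unfolding d using pos[OF h] by (simp add: divide_eq_eq)
  qed
  let ?F = "\<lambda>c. {x \<in> B. c \<bullet> (x - f) = 1}"
  have Fd: "?F (d h) = B \<inter> {x. a h \<bullet> x = b h}" if "h \<in> \<F>" for h
    using eq[OF that] by blast
  have "facet_description f B (d ` \<F>)"
    unfolding facet_description_def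
  proof (intro conjI)
    show "finite (d ` \<F>)" using fin by simp
    have "B = \<Inter>\<F>" using seq unfolding aff by blast
    then show "B = {x. \<forall>c\<in>d ` \<F>. c \<bullet> (x - f) \<le> 1}" using le by auto
    have facets: "{F. F facet_of B} = ?F ` d ` \<F>" 
      using Fd facet by (auto simp: image_image)
    show "bij_betw ?F (d ` \<F>) {F. F facet_of B}"
      unfolding bij_betw_def
    proof
      show "inj_on ?F (d ` \<F>)"
      proof (rule inj_onI)
        fix c c' assume c: "c \<in> d ` \<F>" and eq: "?F c = ?F c'"
        have "?F c \<in> ?F ` d ` \<F>" using c by (rule imageI)
        then have "?F c facet_of B" unfolding facets[symmetric] by simp
        then show "c = c'" using eq by (rule facet_normal_unique[OF f])
      qed
    qed (use facets in simp)
  qed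
  then show ?thesis by (rule ex1I) (metis facet_description_unique[OF f] \<open>facet_description f B (d ` \<F>)\<close>)
qed

end

theory Submission
  imports Defs
begin

text \<open>Every valid function dominates a sublinear valid one (its sublinear hull), and a sublinear
  \<open>\<psi>\<close> is valid iff \<open>\<psi>(x - f) \<ge> 1\<close> on \<open>S\<close>; by Zorn's lemma, minimal valid functions exist below
  every valid function. Let \<open>\<psi>\<close> be a minimal valid function and \<open>L\<close> its lineality space. Whenever
  \<open>\<psi> \<ge> 1\<close> holds on all lines \<open>x - f + \<real> d\<close> with \<open>x \<in> S\<close>, minimality forces \<open>d \<in> L\<close>. Together with
  simultaneous Diophantine approximation this shows that recession directions \<open>r\<close> of the polyhedron
  with \<open>\<psi>(r) \<le> 0\<close> lie in \<open>L\<close>, and that sets of points of \<open>S\<close> that are bounded modulo \<open>L\<close> are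
  finite modulo \<open>L\<close>. Hence finitely many subgradients already give a valid function, so \<open>\<psi>\<close> is a
  maximum of finitely many linear functions; in a smallest such representation every linear function
  \<open>a\<close> has a point of \<open>S\<close> at which \<open>a\<close> equals 1 and all others are below 1. Therefore
  \<open>B = {x. \<psi>(x - f) \<le> 1}\<close> is maximal \<open>S\<close>-free with facet normals these \<open>a\<close>, and \<open>\<psi>\<^sub>B = \<psi>\<close>.
  Conversely, the gauge of a maximal \<open>S\<close>-free set \<open>B\<close> is valid, and the body of a minimal valid
  function below it contains \<open>B\<close>, hence equals \<open>B\<close>.\<close>

section \<open>Sublinear functions\<close>

text \<open>Homogeneity is asked only as an inequality for positive factors, which is easier to
  check for infima; applying it to a factor and its reciprocal gives equality in
  \<open>sublinear_scale\<close>.\<close>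

definition sublinear :: "('a::real_vector \<Rightarrow> real) \<Rightarrow> bool" where
  "sublinear h \<longleftrightarrow> (\<forall>r s. h (r + s) \<le> h r + h s) \<and> (\<forall>t>0. \<forall>r. h (t *\<^sub>R r) \<le> t * h r)"

lemma sublinear_add: "sublinear h \<Longrightarrow> h (r + s) \<le> h r + h s"
  by (simp add: sublinear_def)

lemma sublinear_scale:
  assumes h: "sublinear h" and t: "t \<ge> 0"
  shows "h (t *\<^sub>R r) = t * h r"
proof -
  have le: "h (t *\<^sub>R r) \<le> t * h r" if "t > 0" for t r
    using h that by (simp add: sublinear_def)
  have "h 0 \<le> 2 * h 0" "h 0 \<le> (1/2) * h 0"
    using le[of 2 0] le[of "1/2" 0] by simp_all
  then have h0: "h 0 = 0" by simp
  show ?thesis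
  proof (cases "t = 0")
    case False
    then have pos: "t > 0" using t by simp
    have "h ((1/t) *\<^sub>R (t *\<^sub>R r)) \<le> (1/t) * h (t *\<^sub>R r)"
      using pos by (intro le) simp
    then have "t * h r \<le> h (t *\<^sub>R r)"
      using pos by (simp add: field_simps)
    then show ?thesis using le[OF pos, of r] by simp
  qed (simp add: h0)
qed

lemma sublinear_0: "sublinear h \<Longrightarrow> h 0 = 0"
  using sublinear_scale[of h 0 0] by simp

lemma sublinear_minus: "sublinear h \<Longrightarrow> - h (- r) \<le> h r"
  using sublinear_add[of h r "- r"] sublinear_0[of h] by simp

lemma sublinear_sum:
  assumes h: "sublinear h" and F: "finite F" and nn: "\<And>q. q \<in> F \<Longrightarrow> 0 \<le> s q"
  shows "h (\<Sum>q\<in>F. s q *\<^sub>R q) \<le> (\<Sum>q\<in>F. h q * s q)"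
  using F nn
proof (induction F rule: finite_induct)
  case empty
  then show ?case using sublinear_0[OF h] by simp
next
  case (insert q F)
  have "h (s q *\<^sub>R q + (\<Sum>q\<in>F. s q *\<^sub>R q)) \<le> h (s q *\<^sub>R q) + h (\<Sum>q\<in>F. s q *\<^sub>R q)"
    by (rule sublinear_add[OF h])
  also have "\<dots> \<le> h q * s q + (\<Sum>q\<in>F. h q * s q)"
    using insert sublinear_scale[OF h, of "s q" q] by (simp add: mult.commute)
  finally show ?case using insert by simp
qed

lemma sublinear_continuous:
  fixes h :: "'a::euclidean_space \<Rightarrow> real"
  assumes h: "sublinear h"
  shows "continuous_on X h"
proof -
  have "convex_on UNIV h"
  proof (rule convex_onI)
    fix t :: real and x y :: 'a
    assume "0 < t" "t < 1"
    then show "h ((1 - t) *\<^sub>R x + t *\<^sub>R y) \<le> (1 - t) * h x + t * h y"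
      using sublinear_add[OF h, of "(1 - t) *\<^sub>R x" "t *\<^sub>R y"] sublinear_scale[OF h] by simp
  qed simp
  then have "continuous_on UNIV h" by (intro convex_on_continuous) auto
  then show ?thesis using continuous_on_subset by blast
qed

lemma sublinear_bound:
  fixes h :: "'a::euclidean_space \<Rightarrow> real"
  assumes h: "sublinear h"
  shows "\<exists>C>0. \<forall>r. h r \<le> C * norm r"
proof -
  have "isCont h 0"
    using sublinear_continuous[OF h, of UNIV] by (simp add: continuous_on_eq_continuous_at)
  then obtain d where d: "d > 0" "\<And>x. norm x < d \<Longrightarrow> h x < 1"
    using sublinear_0[OF h] unfolding continuous_at_eps_delta
    by (metis abs_less_iff diff_zero dist_norm less_numeral_extra(1) real_norm_def)
  have "h r \<le> (2 / d) * norm r" for r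
  proof (cases "r = 0")
    case False
    define c where "c = d / (2 * norm r)"
    have c: "c > 0" using d False by (simp add: c_def)
    have "norm (c *\<^sub>R r) < d" using d False by (simp add: c_def)
    then have "c * h r < 1" using d(2) sublinear_scale[OF h, of c r] c by fastforce
    then have "h r < 1 / c" using c by (simp add: field_simps)
    then show ?thesis by (simp add: c_def)
  qed (simp add: sublinear_0[OF h])
  then show ?thesis using d(1) by (intro exI[of _ "2/d"]) simp
qed

text \<open>Hahn-Banach by separation: a hyperplane separates \<open>y\<close> from the convex set
  \<open>?C\<close> and is rescaled to take the value \<open>h y\<close> at \<open>y\<close>. As
  \<open>h y > 0\<close>, the set \<open>?C\<close> contains a ball around 0, so the functional is
  positive at \<open>y\<close>.\<close>

lemma sublinear_subgradient:
  fixes h :: "'a::euclidean_space \<Rightarrow> real"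
  assumes h: "sublinear h" and y: "h y > 0"
  shows "\<exists>a. a \<bullet> y = h y \<and> (\<forall>r. a \<bullet> r \<le> h r)"
proof -
  let ?C = "{x. h x < h y}"
  have "convex ?C"
  proof (rule convexI)
    fix x z and u v :: real
    assume *: "x \<in> ?C" "z \<in> ?C" "u \<ge> 0" "v \<ge> 0" "u + v = 1"
    have "h (u *\<^sub>R x + v *\<^sub>R z) \<le> u * h x + v * h z"
      using sublinear_add[OF h, of "u *\<^sub>R x" "v *\<^sub>R z"] sublinear_scale[OF h] * by simp
    also have "\<dots> < h y"
      using * convex_bound_lt[of "h x" "h y" "h z" u v] by simp
    finally show "u *\<^sub>R x + v *\<^sub>R z \<in> ?C" by simp
  qed
  moreover have C0: "0 \<in> ?C" using y sublinear_0[OF h] by simp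
  ultimately obtain a b where a0: "a \<noteq> 0" and aC: "\<And>x. x \<in> ?C \<Longrightarrow> a \<bullet> x \<le> b" and ay: "b \<le> a \<bullet> y"
    using separating_hyperplane_sets[of ?C "{y}"] by auto
  have "open ?C"
    using sublinear_continuous[OF h, of UNIV] by (intro open_Collect_less) auto
  then obtain e where e: "e > 0" "cball 0 e \<subseteq> ?C"
    using C0 open_contains_cball by blast
  have "(e / norm a) *\<^sub>R a \<in> cball 0 e" using a0 e(1) by simp
  then have "a \<bullet> ((e / norm a) *\<^sub>R a) \<le> b" using e(2) aC by blast
  moreover have "a \<bullet> ((e / norm a) *\<^sub>R a) > 0" using a0 e(1) by simp
  ultimately have ayp: "a \<bullet> y > 0" using ay by simp
  define c where "c = (h y / (a \<bullet> y)) *\<^sub>R a"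
  have cy: "c \<bullet> y = h y" using ayp by (simp add: c_def)
  have cC: "c \<bullet> x \<le> h y" if "x \<in> ?C" for x
  proof -
    have "c \<bullet> x = h y * ((a \<bullet> x) / (a \<bullet> y))" by (simp add: c_def)
    also have "\<dots> \<le> h y * 1"
      using y ayp aC[OF that] ay by (intro mult_left_mono) auto
    finally show ?thesis by simp
  qed
  \<comment> \<open>Where \<open>h\<close> is nonnegative, dividing by \<open>s\<close> brings
    \<open>r\<close> into \<open>?C\<close>; the slack \<epsilon> also covers
    \<open>h r = 0\<close>.\<close>
  have pos: "c \<bullet> r \<le> h r" if r: "h r \<ge> 0" for r
  proof (rule field_le_epsilon)
    fix \<epsilon> :: real assume \<epsilon>: "\<epsilon> > 0"
    define s where "s = (h r + \<epsilon>) / h y"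
    have s: "s > 0" using r \<epsilon> y by (simp add: s_def)
    have "h ((1/s) *\<^sub>R r) = h r / s" using s sublinear_scale[OF h, of "1/s" r] by simp
    also have "\<dots> < h y" using s \<epsilon> y by (simp add: s_def field_simps)
    finally have "c \<bullet> ((1/s) *\<^sub>R r) \<le> h y" by (intro cC) simp
    then have "c \<bullet> r \<le> s * h y" using s by (simp add: field_simps)
    then show "c \<bullet> r \<le> h r + \<epsilon>" using y by (simp add: s_def)
  qed
  have "c \<bullet> r \<le> h r" for r
  proof -
    \<comment> \<open>Adding \<open>t\<close> copies of \<open>y\<close> lifts \<open>h\<close> to a
      nonnegative value; the added \<open>t * h y\<close> cancels afterwards because
      \<open>c\<close> and \<open>h\<close> agree at \<open>y\<close>.\<close>
    define t where "t = max 0 (h (- r) / h y)"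
    have t: "t \<ge> 0" "t * h y \<ge> h (- r)" 
      using y by (auto simp: t_def max_def field_simps)
    have "h (t *\<^sub>R y) \<le> h (r + t *\<^sub>R y) + h (- r)"
      using sublinear_add[OF h, of "r + t *\<^sub>R y" "- r"] by simp
    then have "h (r + t *\<^sub>R y) \<ge> 0" using t sublinear_scale[OF h, of t y] by simp
    then have "c \<bullet> r + t * h y \<le> h (r + t *\<^sub>R y)" 
      using pos[of "r + t *\<^sub>R y"] cy by (simp add: inner_add_right)
    also have "\<dots> \<le> h r + t * h y"
      using sublinear_add[OF h, of r "t *\<^sub>R y"] sublinear_scale[OF h t(1), of y] by simp
    finally show ?thesis by simp
  qed
  then show ?thesis using cy by blast
qed

section \<open>Support functions of finite sets\<close>

definition support_max :: "'a::real_inner set \<Rightarrow> 'a \<Rightarrow> real" where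
  "support_max A r = Max ((\<lambda>a. a \<bullet> r) ` A)"

lemma support_max_ge: "finite A \<Longrightarrow> a \<in> A \<Longrightarrow> a \<bullet> r \<le> support_max A r"
  by (simp add: support_max_def)

lemma support_max_le_iff:
  "finite A \<Longrightarrow> A \<noteq> {} \<Longrightarrow> support_max A r \<le> c \<longleftrightarrow> (\<forall>a\<in>A. a \<bullet> r \<le> c)"
  by (simp add: support_max_def)

lemma support_max_attained:
  assumes "finite A" "A \<noteq> {}"
  obtains a where "a \<in> A" "support_max A r = a \<bullet> r"
proof -
  have "support_max A r \<in> (\<lambda>a. a \<bullet> r) ` A"
    unfolding support_max_def using assms by (intro Max_in) auto
  then show thesis using that by blast
qed

lemma sublinear_support_max:
  assumes A: "finite A" "A \<noteq> {}"
  shows "sublinear (support_max A)"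
  unfolding sublinear_def
proof (intro conjI allI impI)
  fix r s show "support_max A (r + s) \<le> support_max A r + support_max A s"
    using support_max_ge[OF A(1)]
    by (subst support_max_le_iff[OF A]) (auto simp: inner_add_right intro!: add_mono)
next
  fix t :: real and r assume "t > 0"
  then show "support_max A (t *\<^sub>R r) \<le> t * support_max A r"
    using support_max_ge[OF A(1)] by (subst support_max_le_iff[OF A]) auto
qed

lemma support_max_mono:
  assumes "finite A" "A' \<subseteq> A" "A' \<noteq> {}"
  shows "support_max A' r \<le> support_max A r"
  unfolding support_max_def using assms by (intro Max_mono) auto

section \<open>Validity and the sublinear hull\<close>

definition sublinear_valid :: "'a::real_vector \<Rightarrow> 'a set \<Rightarrow> ('a \<Rightarrow> real) \<Rightarrow> bool" where
  "sublinear_valid f S h \<longleftrightarrow> sublinear h \<and> (\<forall>x\<in>S. h (x - f) \<ge> 1)"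

lemma sublinear_valid_imp_valid_fun:
  assumes "sublinear_valid f S h"
  shows "valid_fun f S h"
  unfolding valid_fun_def
proof
  fix s assume s: "s \<in> feasible f S"
  have h: "sublinear h" using assms by (simp add: sublinear_valid_def)
  let ?r = "\<Sum>r | s r \<noteq> 0. s r *\<^sub>R r"
  have "f + ?r \<in> S" using s by (simp add: feasible_def)
  then have "1 \<le> h (f + ?r - f)" using assms unfolding sublinear_valid_def by blast
  then have "1 \<le> h ?r" by simp
  also have "\<dots> \<le> (\<Sum>r | s r \<noteq> 0. h r * s r)"
    using s by (intro sublinear_sum[OF h]) (auto simp: feasible_def)
  finally show "1 \<le> (\<Sum>r | s r \<noteq> 0. h r * s r)" .
qed

text \<open>The convex cone generated by the graph of \<open>\<psi>\<close>; its lower boundary is the sublinear hull.\<close>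

inductive graph_cone :: "('a::real_vector \<Rightarrow> real) \<Rightarrow> 'a \<Rightarrow> real \<Rightarrow> bool" for \<psi> where
  zero: "graph_cone \<psi> 0 0"
| step: "graph_cone \<psi> r c \<Longrightarrow> t \<ge> 0 \<Longrightarrow> graph_cone \<psi> (r + t *\<^sub>R q) (c + t * \<psi> q)"

lemma graph_cone_add:
  assumes "graph_cone \<psi> r c" "graph_cone \<psi> s d"
  shows "graph_cone \<psi> (r + s) (c + d)"
  using assms(2,1)
proof (induction rule: graph_cone.induct)
  case (step s d t q)
  then show ?case using graph_cone.step[of \<psi> "r + s" "c + d" t q] by (simp add: add.assoc)
qed simp

lemma graph_cone_scale:
  assumes "graph_cone \<psi> r c" "u \<ge> 0"
  shows "graph_cone \<psi> (u *\<^sub>R r) (u * c)"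
  using assms
proof (induction rule: graph_cone.induct)
  case (step r c t q)
  then show ?case using graph_cone.step[of \<psi> "u *\<^sub>R r" "u * c" "u * t" q]
    by (simp add: algebra_simps)
qed (simp add: graph_cone.zero)

lemma graph_cone_graph: "graph_cone \<psi> r (\<psi> r)"
  using graph_cone.step[OF graph_cone.zero, of 1 \<psi> r] by simp

text \<open>Merging repeated generators gives a single finitely supported weight function, the form
  in which \<open>feasible\<close> is stated.\<close>

lemma graph_cone_combination:
  assumes "graph_cone \<psi> r c"
  shows "\<exists>s. finite {q. s q \<noteq> 0} \<and> (\<forall>q. 0 \<le> s q) \<and>
    r = (\<Sum>q | s q \<noteq> 0. s q *\<^sub>R q) \<and> c = (\<Sum>q | s q \<noteq> 0. \<psi> q * s q)"
  using assms
proof (induction rule: graph_cone.induct)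
  case zero
  show ?case by (rule exI[of _ "\<lambda>_. 0"]) simp
next
  case (step r c t q)
  then obtain s where s: "finite {q. s q \<noteq> 0}" "\<forall>q. 0 \<le> s q"
    "r = (\<Sum>q | s q \<noteq> 0. s q *\<^sub>R q)" "c = (\<Sum>q | s q \<noteq> 0. \<psi> q * s q)" by blast
  define s' where "s' = s(q := s q + t)"
  \<comment> \<open>The support of \<open>s'\<close> omits \<open>q\<close> when both
    \<open>s q\<close> and \<open>t\<close> vanish, so all sums are compared on the fixed set
    \<open>?F\<close>.\<close>
  let ?F = "insert q {q. s q \<noteq> 0}"
  have sub: "{q. s' q \<noteq> 0} \<subseteq> ?F" by (auto simp: s'_def)
  have fin: "finite ?F" using s by simp
  have eq: "(\<Sum>p\<in>?F. s' p *\<^sub>R p) = (\<Sum>p\<in>?F. s p *\<^sub>R p) + t *\<^sub>R q"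
    "(\<Sum>p\<in>?F. \<psi> p * s' p) = (\<Sum>p\<in>?F. \<psi> p * s p) + t * \<psi> q"
    using s(1) by (auto simp: s'_def sum.insert_remove algebra_simps intro!: sum.cong)
  show ?case
  proof (intro exI[of _ s'] conjI)
    show "finite {q. s' q \<noteq> 0}" using sub fin finite_subset by blast
    show "\<forall>q. 0 \<le> s' q" using s \<open>t \<ge> 0\<close> by (simp add: s'_def)
    have "(\<Sum>p | s' p \<noteq> 0. s' p *\<^sub>R p) = (\<Sum>p\<in>?F. s' p *\<^sub>R p)"
      by (rule sum.mono_neutral_left[OF fin sub]) auto
    moreover have "(\<Sum>p\<in>?F. s p *\<^sub>R p) = r"
      unfolding s(3) by (rule sum.mono_neutral_right[OF fin]) auto
    ultimately show "r + t *\<^sub>R q = (\<Sum>p | s' p \<noteq> 0. s' p *\<^sub>R p)" using eq by simp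
    have "(\<Sum>p | s' p \<noteq> 0. \<psi> p * s' p) = (\<Sum>p\<in>?F. \<psi> p * s' p)"
      by (rule sum.mono_neutral_left[OF fin sub]) auto
    moreover have "(\<Sum>p\<in>?F. \<psi> p * s p) = c"
      unfolding s(4) by (rule sum.mono_neutral_right[OF fin]) auto
    ultimately show "c + t * \<psi> q = (\<Sum>p | s' p \<noteq> 0. \<psi> p * s' p)" using eq by simp
  qed
qed

lemma valid_fun_graph_cone:
  assumes "valid_fun f S \<psi>" "graph_cone \<psi> r c" "f + r \<in> S"
  shows "c \<ge> 1"
  using graph_cone_combination[OF assms(2)] assms(1,3)
  by (auto simp: valid_fun_def feasible_def)

text \<open>Closure of the cone under addition and scaling makes its lower boundary \<open>h\<close>
  sublinear, and validity of \<psi> keeps every height of the cone above \<open>x - f\<close> at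
  least 1.\<close>

lemma sublinear_valid_below_valid_fun:
  assumes S: "S \<noteq> {}" and v: "valid_fun f S \<psi>"
  shows "\<exists>h. sublinear_valid f S h \<and> (\<forall>r. h r \<le> \<psi> r)"
proof -
  let ?G = "graph_cone \<psi>"
  obtain x where x: "x \<in> S" using S by blast
  \<comment> \<open>Completing \<open>r\<close> by \<open>x - f - r\<close> reaches
    \<open>x - f\<close>, where all heights are at least 1; this keeps the infimum \<open>h\<close>
    finite.\<close>
  have bound: "c \<ge> 1 - \<psi> (x - f - r)" if "?G r c" for r c
    using valid_fun_graph_cone[OF v graph_cone_add[OF that graph_cone_graph[of \<psi> "x - f - r"]]] x
    by simp
  define h where "h r = Inf {c. ?G r c}" for r
  have bdd: "bdd_below {c. ?G r c}" for r
    using bound by (intro bdd_belowI[of _ "1 - \<psi> (x - f - r)"]) auto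
  have ne: "{c. ?G r c} \<noteq> {}" for r using graph_cone_graph by blast
  have lower: "h r \<le> c" if "?G r c" for r c
    unfolding h_def using that bdd by (intro cInf_lower) auto
  have greatest: "m \<le> h r" if "\<And>c. ?G r c \<Longrightarrow> m \<le> c" for r m
    unfolding h_def using that ne by (intro cInf_greatest) auto
  have "sublinear h"
    unfolding sublinear_def
  proof (intro conjI allI impI)
    fix r s
    have "h (r + s) - h s \<le> h r"
    proof (rule greatest)
      fix c assume c: "?G r c"
      have "h (r + s) - c \<le> h s"
        using lower[OF graph_cone_add[OF c]] by (intro greatest) (metis diff_le_eq add.commute)
      then show "h (r + s) - h s \<le> c" by simp
    qed
    then show "h (r + s) \<le> h r + h s" by simp
  next
    fix t :: real and r assume t: "t > 0"
    have "h (t *\<^sub>R r) / t \<le> h r"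
      using lower[OF graph_cone_scale[of \<psi> r _ t]] t
      by (intro greatest) (simp add: field_simps)
    then show "h (t *\<^sub>R r) \<le> t * h r" using t by (simp add: field_simps)
  qed
  moreover have "1 \<le> h (x - f)" if "x \<in> S" for x
    using valid_fun_graph_cone[OF v] that by (intro greatest) auto
  ultimately show ?thesis
    using lower[OF graph_cone_graph] unfolding sublinear_valid_def by blast
qed

text \<open>Only sublinear competitors need checking: any valid function below \<open>h\<close> has
  a sublinear valid function below it, which \<open>min\<close> identifies with
  \<open>h\<close>.\<close>

lemma minimal_valid_funI:
  assumes S: "S \<noteq> {}" and v: "sublinear_valid f S h"
    and min: "\<And>h'. sublinear_valid f S h' \<Longrightarrow> (\<And>r. h' r \<le> h r) \<Longrightarrow> h' = h"
  shows "minimal_valid_fun f S h"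
  unfolding minimal_valid_fun_def
proof (intro conjI notI)
  assume "\<exists>\<psi>. valid_fun f S \<psi> \<and> \<psi> \<noteq> h \<and> dominates \<psi> h"
  then obtain \<psi> where \<psi>: "valid_fun f S \<psi>" "\<psi> \<noteq> h" "\<And>r. \<psi> r \<le> h r"
    unfolding dominates_def by blast
  obtain h' where h': "sublinear_valid f S h'" "\<And>r. h' r \<le> \<psi> r"
    using sublinear_valid_below_valid_fun[OF S \<psi>(1)] by blast
  then have "h' = h" using \<psi>(3) order_trans by (intro min) blast+
  then have "\<psi> = h" using h'(2) \<psi>(3) by (intro ext antisym) auto
  then show False using \<psi> by simp
qed (rule sublinear_valid_imp_valid_fun[OF v])

lemma minimal_valid_fun_sublinear:
  assumes S: "S \<noteq> {}" and min: "minimal_valid_fun f S \<psi>"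
  shows "sublinear_valid f S \<psi>"
proof -
  have v: "valid_fun f S \<psi>" using min by (simp add: minimal_valid_fun_def)
  obtain h where h: "sublinear_valid f S h" "\<And>r. h r \<le> \<psi> r"
    using sublinear_valid_below_valid_fun[OF S v] by blast
  then have "h = \<psi>"
    using min sublinear_valid_imp_valid_fun[OF h(1)] unfolding minimal_valid_fun_def dominates_def
    by blast
  then show ?thesis using h by simp
qed

lemma minimal_valid_funD:
  assumes "minimal_valid_fun f S \<psi>" "sublinear_valid f S h" "\<And>r. h r \<le> \<psi> r"
  shows "h = \<psi>"
  using assms sublinear_valid_imp_valid_fun unfolding minimal_valid_fun_def dominates_def by blast

section \<open>Existence of minimal valid functions\<close>

text \<open>In a chain, the smaller function \<open>m\<close> of \<open>h\<close> and
  \<open>h'\<close> bounds both summands at once; for arbitrary families the infimum need not be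
  subadditive.\<close>

lemma sublinear_Inf_chain:
  fixes C :: "('a::real_vector \<Rightarrow> real) set"
  assumes ne: "C \<noteq> {}" and sub: "\<And>h. h \<in> C \<Longrightarrow> sublinear h"
    and chain: "\<And>h h'. h \<in> C \<Longrightarrow> h' \<in> C \<Longrightarrow> h \<le> h' \<or> h' \<le> h"
    and bdd: "\<And>r. bdd_below ((\<lambda>h. h r) ` C)"
  shows "sublinear (\<lambda>r. INF h\<in>C. h r)"
  unfolding sublinear_def
proof (intro conjI allI impI)
  let ?u = "\<lambda>r. INF h\<in>C. h r"
  have lower: "?u r \<le> h r" if "h \<in> C" for h r
    using bdd that by (rule cINF_lower)
  fix r s :: 'a
  have "?u (r + s) - ?u s \<le> ?u r"
  proof (rule cINF_greatest[OF ne])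
    fix h assume h: "h \<in> C"
    have "?u (r + s) - h r \<le> ?u s"
    proof (rule cINF_greatest[OF ne])
      fix h' assume h': "h' \<in> C"
      define m where "m = (if h \<le> h' then h else h')"
      have m: "m \<in> C" "m \<le> h" "m \<le> h'" using h h' chain by (auto simp: m_def)
      have "?u (r + s) \<le> m (r + s)" by (rule lower[OF m(1)])
      also have "\<dots> \<le> m r + m s" by (rule sublinear_add[OF sub[OF m(1)]])
      also have "\<dots> \<le> h r + h' s" using m by (intro add_mono) (auto simp: le_fun_def)
      finally show "?u (r + s) - h r \<le> h' s" by simp
    qed
    then show "?u (r + s) - ?u s \<le> h r" by simp
  qed
  then show "?u (r + s) \<le> ?u r + ?u s" by simp
next
  let ?u = "\<lambda>r. INF h\<in>C. h r"
  fix t :: real and r :: 'a assume t: "t > 0"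
  have "?u (t *\<^sub>R r) / t \<le> ?u r"
  proof (rule cINF_greatest[OF ne])
    fix h assume h: "h \<in> C"
    have "?u (t *\<^sub>R r) \<le> h (t *\<^sub>R r)" using bdd h by (rule cINF_lower)
    also have "\<dots> = t * h r" using sublinear_scale[OF sub[OF h]] t by simp
    finally show "?u (t *\<^sub>R r) / t \<le> h r" using t by (simp add: field_simps)
  qed
  then show "?u (t *\<^sub>R r) \<le> t * ?u r" using t by (simp add: field_simps)
qed

text \<open>Zorn's lemma on the sublinear valid functions below \<open>g\<close>, with the order
  reversed so that a chain is bounded by its pointwise infimum.\<close>

lemma minimal_valid_fun_below:
  assumes S: "S \<noteq> {}" and g: "sublinear_valid f S g"
  shows "\<exists>\<psi>. minimal_valid_fun f S \<psi> \<and> (\<forall>r. \<psi> r \<le> g r)"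
proof -
  define X where "X = {h. sublinear_valid f S h \<and> h \<le> g}"
  have "\<exists>m\<in>X. \<forall>h\<in>X. h \<le> m \<longrightarrow> h = m"
  proof (rule predicate_Zorn)
    show "partial_order_on X (relation_of (\<lambda>h h'. h' \<le> h) X)"
      by (rule partial_order_on_relation_ofI) auto
  next
    fix C assume C: "C \<in> Chains (relation_of (\<lambda>h h'. h' \<le> h) X)"
    have CX: "C \<subseteq> X" and chain: "h \<le> h' \<or> h' \<le> h" if "h \<in> C" "h' \<in> C" for h h'
      using C that unfolding Chains_def relation_of_def by auto
    then have CX: "C \<subseteq> X" by blast
    show "\<exists>u\<in>X. \<forall>h\<in>C. u \<le> h"
    proof (cases "C = {}")
      case True
      then show ?thesis using g by (auto simp: X_def)
    next
      case False
      \<comment> \<open>The values stay bounded below since \<open>h (- r)\<close> is at most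
        \<open>g (- r)\<close> and \<open>h r + h (- r)\<close> is nonnegative.\<close>
      have bdd: "bdd_below ((\<lambda>h. h r) ` C)" for r
      proof (rule bdd_belowI2[of _ "- g (- r)"])
        fix h assume "h \<in> C"
        then have "sublinear h" "h (- r) \<le> g (- r)"
          using CX by (auto simp: X_def sublinear_valid_def le_fun_def)
        then show "- g (- r) \<le> h r" using sublinear_minus[of h r] by simp
      qed
      define u where "u r = (INF h\<in>C. h r)" for r
      have lower: "u r \<le> h r" if "h \<in> C" for h r
        unfolding u_def using bdd that by (rule cINF_lower)
      have "sublinear u"
        unfolding u_def using False CX chain bdd
        by (intro sublinear_Inf_chain) (auto simp: X_def sublinear_valid_def)
      moreover have "1 \<le> u (x - f)" if "x \<in> S" for x
        unfolding u_def using CX that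
        by (intro cINF_greatest[OF False]) (auto simp: X_def sublinear_valid_def)
      moreover obtain h where "h \<in> C" using False by blast
      then have "u \<le> g" using lower CX by (force simp: X_def le_fun_def intro: order_trans)
      ultimately have "u \<in> X" by (auto simp: X_def sublinear_valid_def)
      then show ?thesis using lower by (auto simp: le_fun_def)
    qed
  qed
  then obtain m where m: "sublinear_valid f S m" "m \<le> g"
    and min: "\<And>h. sublinear_valid f S h \<Longrightarrow> h \<le> g \<Longrightarrow> h \<le> m \<Longrightarrow> h = m"
    unfolding X_def by blast
  have "minimal_valid_fun f S m"
  proof (rule minimal_valid_funI[OF S m(1)])
    fix h assume "sublinear_valid f S h" "\<And>r. h r \<le> m r"
    then show "h = m" using m(2) by (intro min) (auto simp: le_fun_def intro: order_trans)
  qed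
  then show ?thesis using m(2) by (auto simp: le_fun_def)
qed

section \<open>Linear images of polyhedral cones\<close>

text \<open>Linear images of closed cones need not be closed, but this cone is finitely generated:
  its intersection with a cube around 0 is a polytope whose vertices generate it. The image is then
  finitely generated too, hence closed.\<close>

lemma closed_linear_image_polyhedral_cone:
  fixes M :: "'a::euclidean_space set" and p :: "'a \<Rightarrow> 'b::euclidean_space"
  assumes M: "finite M" and p: "linear p"
  shows "closed (p ` {x. \<forall>a\<in>M. a \<bullet> x \<le> 0})"
proof -
  let ?R = "{x. \<forall>a\<in>M. a \<bullet> x \<le> 0}"
  let ?Q = "?R \<inter> cbox (- One) One"
  have cone: "convex_cone ?R"
    unfolding convex_cone_iff
  proof (intro conjI ballI allI impI)
    fix x y assume "x \<in> ?R" "y \<in> ?R"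
    then show "x + y \<in> ?R" by (auto simp: inner_add_right intro: add_nonpos_nonpos)
  next
    fix x and c :: real assume "x \<in> ?R" "0 \<le> c"
    then show "c *\<^sub>R x \<in> ?R" by (auto simp: mult_nonneg_nonpos)
  qed simp
  have "?R = (\<Inter>a\<in>M. {x. a \<bullet> x \<le> 0})" by blast
  moreover have "polyhedron (\<Inter>a\<in>M. {x. a \<bullet> x \<le> 0})"
    using M polyhedron_halfspace_le by (intro polyhedron_Inter) auto
  ultimately have "polyhedron ?R" by (rule ssubst)
  then have "polytope ?Q"
    using polytope_Int_polyhedron[OF polytope_interval] by (subst Int_commute)
  then obtain V where V: "finite V" "?Q = convex hull V"
    unfolding polytope_def by blast
  have "?R = convex_cone hull V"
  proof
    have "V \<subseteq> ?R" using V(2) hull_subset[of V convex] by blast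
    then show "convex_cone hull V \<subseteq> ?R" using cone by (rule hull_minimal)
  next
    show "?R \<subseteq> convex_cone hull V"
    proof
      fix x assume x: "x \<in> ?R"
      define t where "t = 1 / (1 + norm x)"
      have t: "t > 0" by (simp add: t_def add_pos_nonneg)
      have "norm (t *\<^sub>R x) = norm x / (1 + norm x)" by (simp add: t_def add_nonneg_nonneg)
      also have "\<dots> \<le> 1" by (subst divide_le_eq_1_pos) (simp_all add: add_pos_nonneg)
      finally have n1: "norm (t *\<^sub>R x) \<le> 1" .
      have "t *\<^sub>R x \<in> cbox (- One) One"
        unfolding mem_box
      proof (intro ballI)
        fix i :: 'a assume i: "i \<in> Basis"
        then have "One \<bullet> i = 1" by simp
        moreover have "\<bar>(t *\<^sub>R x) \<bullet> i\<bar> \<le> 1" using Basis_le_norm[OF i, of "t *\<^sub>R x"] n1 by linarith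
        ultimately show "- One \<bullet> i \<le> (t *\<^sub>R x) \<bullet> i \<and> (t *\<^sub>R x) \<bullet> i \<le> One \<bullet> i"
          unfolding inner_minus_left abs_le_iff by linarith
      qed
      moreover have "t *\<^sub>R x \<in> ?R" using x t by (auto simp: mult_nonneg_nonpos)
      ultimately have "t *\<^sub>R x \<in> convex hull V" using V(2) by blast
      also have "\<dots> \<subseteq> convex_cone hull V"
        by (simp add: hull_minimal hull_subset convex_convex_cone_hull)
      finally have tx: "t *\<^sub>R x \<in> convex_cone hull V" .
      have "(1/t) *\<^sub>R (t *\<^sub>R x) \<in> convex_cone hull V"
        using t by (intro convex_cone_hull_mul[OF tx]) simp
      moreover have "(1/t) *\<^sub>R (t *\<^sub>R x) = x" using t by simp
      ultimately show "x \<in> convex_cone hull V" by (simp only:)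
    qed
  qed
  then have "p ` ?R = convex_cone hull (p ` V)"
    using convex_cone_hull_linear_image[OF p, of V] by simp
  then show ?thesis using V(1) by (simp add: closed_convex_cone_hull)
qed

section \<open>Integer points and simultaneous approximation\<close>

lemma integer_points_add: "x \<in> integer_points \<Longrightarrow> y \<in> integer_points \<Longrightarrow> x + y \<in> integer_points"
  and integer_points_diff: "x \<in> integer_points \<Longrightarrow> y \<in> integer_points \<Longrightarrow> x - y \<in> integer_points"
  and integer_points_scale: "x \<in> integer_points \<Longrightarrow> of_nat k *\<^sub>R x \<in> integer_points"
  by (auto simp: integer_points_def)

lemma integer_points_inner:
  "x \<in> integer_points \<Longrightarrow> y \<in> integer_points \<Longrightarrow> x \<bullet> y \<in> \<int>"
  by (auto simp: integer_points_def inner_vec_def intro!: Ints_sum)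

text \<open>If a monotone subsequence increases, it converges and, being integral, is eventually
  constant; its tail is then decreasing as well.\<close>

lemma bounded_integer_sequence_decseq:
  fixes s :: "nat \<Rightarrow> real"
  assumes int: "\<And>i. s i \<in> \<int>" and le: "\<And>i. s i \<le> b"
  shows "\<exists>\<phi>::nat \<Rightarrow> nat. strict_mono \<phi> \<and> decseq (\<lambda>i. s (\<phi> i))"
proof -
  obtain \<phi> :: "nat \<Rightarrow> nat" where \<phi>: "strict_mono \<phi>" "monoseq (\<lambda>i. s (\<phi> i))"
    using seq_monosub[of s] by blast
  show ?thesis
  proof (cases "decseq (\<lambda>i. s (\<phi> i))")
    case False
    then have inc: "incseq (\<lambda>i. s (\<phi> i))" using \<phi>(2) by (simp add: monoseq_iff)
    obtain l where "(\<lambda>i. s (\<phi> i)) \<longlonglongrightarrow> l" using incseq_convergent[OF inc, of b] le by blast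
    then have "Cauchy (\<lambda>i. s (\<phi> i))" using LIMSEQ_imp_Cauchy by blast
    then obtain N where N: "\<And>i j. i \<ge> N \<Longrightarrow> j \<ge> N \<Longrightarrow> \<bar>s (\<phi> i) - s (\<phi> j)\<bar> < 1"
      unfolding Cauchy_def dist_real_def by (metis zero_less_one)
    have "s (\<phi> i) = s (\<phi> j)" if "i \<ge> N" "j \<ge> N" for i j
      using Ints_nonzero_abs_less1[of "s (\<phi> i) - s (\<phi> j)"] N[OF that] int by auto
    then have "decseq (\<lambda>i. s (\<phi> (i + N)))"
      unfolding decseq_def by (metis le_add2 order_refl)
    moreover have "strict_mono (\<lambda>i. \<phi> (i + N))"
      using \<phi>(1) by (simp add: strict_mono_def)
    ultimately show ?thesis by blast
  qed (use \<phi> in blast)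
qed

text \<open>Dickson-type argument: the sequence is thinned out once per row, and passing to a
  subsequence keeps the rows already treated decreasing.\<close>

lemma integer_rows_decseq:
  fixes u :: "nat \<Rightarrow> real ^ 'n"
  assumes A: "finite A" "A \<subseteq> integer_points" and u: "\<And>i. u i \<in> integer_points"
    and le: "\<And>a i. a \<in> A \<Longrightarrow> a \<bullet> u i \<le> b a"
  shows "\<exists>\<phi>::nat \<Rightarrow> nat. strict_mono \<phi> \<and> (\<forall>a\<in>A. decseq (\<lambda>i. a \<bullet> u (\<phi> i)))"
  using A le
proof (induction A rule: finite_induct)
  case empty
  show ?case by (rule exI[of _ "\<lambda>i. i"]) (simp add: strict_mono_def)
next
  case (insert a A)
  then obtain \<phi> :: "nat \<Rightarrow> nat" where \<phi>: "strict_mono \<phi>" "\<forall>a\<in>A. decseq (\<lambda>i. a \<bullet> u (\<phi> i))" by auto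
  have "a \<bullet> u (\<phi> i) \<in> \<int>" "a \<bullet> u (\<phi> i) \<le> b a" for i
    using insert.prems u by (auto intro: integer_points_inner)
  then obtain \<phi>' :: "nat \<Rightarrow> nat" where \<phi>': "strict_mono \<phi>'" "decseq (\<lambda>i. a \<bullet> u (\<phi> (\<phi>' i)))"
    using bounded_integer_sequence_decseq[of "\<lambda>i. a \<bullet> u (\<phi> i)" "b a"] by blast
  have "decseq (\<lambda>i. c \<bullet> u (\<phi> (\<phi>' i)))" if "c \<in> A" for c
    using \<phi>(2) \<phi>'(1) that unfolding decseq_def by (meson strict_mono_less_eq)
  then show ?case
    using \<phi>' strict_mono_o[OF \<phi>(1) \<phi>'(1)]
    by (intro exI[of _ "\<lambda>i. \<phi> (\<phi>' i)"]) (simp add: comp_def)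
qed

text \<open>Dirichlet's theorem is applied to the coordinates of \<open>m *\<^sub>R r\<close>; its
  multiplier \<open>q\<close> is a positive integer, so \<open>l\<close>, the product of
  \<open>q\<close> and \<open>m\<close>, is at least \<open>m\<close>.\<close>

lemma integer_point_near_multiple:
  fixes r :: "real ^ 'n"
  assumes "m > 0" "\<delta> > 0"
  shows "\<exists>l z. l \<ge> m \<and> z \<in> integer_points \<and> norm (z - l *\<^sub>R r) < \<delta>"
proof -
  obtain h where h: "bij_betw h {0..<CARD('n)} (UNIV :: 'n set)"
    using ex_bij_betw_nat_finite[of "UNIV :: 'n set"] by auto
  \<comment> \<open>With this \<open>N\<close>, coordinate errors below \<open>1 / N\<close> add up
    to less than \<delta>.\<close>
  define N where "N = nat \<lceil>real CARD('n) / \<delta>\<rceil> + 1"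
  have N: "N > 0" "real N > real CARD('n) / \<delta>" unfolding N_def using assms by linarith+
  obtain q :: int and p :: "nat \<Rightarrow> int" where q: "q > 0"
    and p: "\<And>i. i < CARD('n) \<Longrightarrow> \<bar>of_int q * (m * r $ h i) - of_int (p i)\<bar> < 1 / real N"
    by (rule Dirichlet_approx_simult[OF N(1), where n = "CARD('n)" and \<theta> = "\<lambda>i. m * r $ h i"]) blast
  define z :: "real ^ 'n" where "z = (\<chi> j. of_int (p (inv_into {0..<CARD('n)} h j)))"
  define l where "l = of_int q * m"
  have near: "\<bar>(z - l *\<^sub>R r) $ j\<bar> < 1 / real N" for j
  proof -
    let ?i = "inv_into {0..<CARD('n)} h j"
    have "j \<in> h ` {0..<CARD('n)}" using h by (simp add: bij_betw_def)
    then have "?i \<in> {0..<CARD('n)}" "h ?i = j" by (rule inv_into_into f_inv_into_f)+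
    then show ?thesis using p[of ?i] by (simp add: z_def l_def abs_minus_commute mult.assoc)
  qed
  have "norm (z - l *\<^sub>R r) \<le> (\<Sum>j\<in>UNIV. \<bar>(z - l *\<^sub>R r) $ j\<bar>)"
    by (rule norm_le_l1_cart)
  also have "\<dots> \<le> (\<Sum>j\<in>(UNIV::'n set). 1 / real N)"
    using near by (intro sum_mono) (simp add: less_imp_le)
  also have "\<dots> = real CARD('n) / real N" by simp
  also have "\<dots> < \<delta>" using N assms by (simp add: field_simps)
  finally have "norm (z - l *\<^sub>R r) < \<delta>" .
  moreover have "l \<ge> m" using q assms by (simp add: l_def)
  moreover have "z \<in> integer_points" by (simp add: z_def integer_points_def)
  ultimately show ?thesis by blast
qed

section \<open>Reduction modulo a subspace\<close>

text \<open>Subtracting the components along an orthogonal basis of \<open>L\<close> gives the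
  orthogonal projection, which picks one representative modulo \<open>L\<close>.\<close>

lemma linear_map_with_kernel:
  fixes L :: "'a::euclidean_space set"
  assumes "subspace L"
  shows "\<exists>p. linear p \<and> (\<forall>x. x - p x \<in> L) \<and> (\<forall>w\<in>L. p w = (0::'a))"
proof -
  obtain B where B: "B \<subseteq> L" "pairwise orthogonal B" "span B = L"
    using orthogonal_basis_subspace[OF assms] by metis
  define p where "p a = a - (\<Sum>b\<in>B. (b \<bullet> a / (b \<bullet> b)) *\<^sub>R b)" for a
  have "linear p"
    unfolding p_def
    by (intro linear_compose_sub linear_id linear_ident linear_compose_sum ballI linearI)
      (auto simp: inner_add_right add_divide_distrib scaleR_add_left)
  moreover have diff: "x - p x \<in> L" for x
    using B(1) assms by (auto simp: p_def intro!: subspace_sum subspace_scale)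
  moreover have "p w = 0" if w: "w \<in> L" for w
  proof -
    have "p w \<in> L" using subspace_diff[OF assms w diff[of w]] by simp
    then have "orthogonal (p w) (p w)"
      using Gram_Schmidt_step[OF B(2)] B(3) unfolding p_def by blast
    then show ?thesis by (simp add: orthogonal_self)
  qed
  ultimately show ?thesis by blast
qed

lemma sublinear_invariant:
  assumes h: "sublinear h" and w: "h w \<le> 0" "h (- w) \<le> 0"
  shows "h (r + w) = h r"
  using sublinear_add[OF h, of r w] sublinear_add[OF h, of "r + w" "- w"] w by simp

section \<open>Integer points of a rational polyhedron\<close>

text \<open>Integer rows take integer values at integer points, which drives the discreteness
  arguments below.\<close>

locale polyhedral_lattice_set =
  fixes I :: "((real ^ 'n) \<times> real) set" and S :: "(real ^ 'n) set"
  assumes finite_rows: "finite I"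
    and integer_rows: "\<And>a b. (a, b) \<in> I \<Longrightarrow> a \<in> integer_points"
    and S_eq: "S = {x \<in> integer_points. \<forall>(a, b)\<in>I. a \<bullet> x \<le> b}"
    and S_nonempty: "S \<noteq> {}"
begin

definition recession :: "(real ^ 'n) set" where
  "recession = {x. \<forall>a\<in>fst ` I. a \<bullet> x \<le> 0}"

text \<open>Once every row decreases along the subsequence, the later term minus the earlier one is
  a recession direction.\<close>

lemma lattice_decseq_subsequence:
  assumes u: "\<And>i. u i \<in> integer_points" and le: "\<And>a b i. (a, b) \<in> I \<Longrightarrow> a \<bullet> u i \<le> c (a, b)"
  shows "\<exists>\<phi>::nat \<Rightarrow> nat. strict_mono \<phi> \<and> (\<forall>i j. i \<le> j \<longrightarrow> u (\<phi> j) - u (\<phi> i) \<in> integer_points \<inter> recession)"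
proof -
  have "\<exists>\<phi>::nat \<Rightarrow> nat. strict_mono \<phi> \<and> (\<forall>a\<in>fst ` I. decseq (\<lambda>i. a \<bullet> u (\<phi> i)))"
  proof (rule integer_rows_decseq[where b = "\<lambda>a. c (a, SOME b. (a, b) \<in> I)"])
    fix a i assume "a \<in> fst ` I"
    then have "(a, SOME b. (a, b) \<in> I) \<in> I" by (auto intro: someI)
    then show "a \<bullet> u i \<le> c (a, SOME b. (a, b) \<in> I)" by (rule le)
  qed (use finite_rows integer_rows u in auto)
  then obtain \<phi> where \<phi>: "strict_mono \<phi>" "\<forall>a\<in>fst ` I. decseq (\<lambda>i. a \<bullet> u (\<phi> i))" by blast
  have "u (\<phi> j) - u (\<phi> i) \<in> integer_points \<inter> recession" if "i \<le> j" for i j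
    using \<phi>(2) that u unfolding decseq_def
    by (auto simp: recession_def inner_diff_right intro!: integer_points_diff)
  then show ?thesis using \<phi>(1) by blast
qed

lemma S_decseq_subsequence:
  assumes "\<And>i. u i \<in> S"
  shows "\<exists>\<phi>::nat \<Rightarrow> nat. strict_mono \<phi> \<and> (\<forall>i j. i \<le> j \<longrightarrow> u (\<phi> j) - u (\<phi> i) \<in> integer_points \<inter> recession)"
  using assms unfolding S_eq by (intro lattice_decseq_subsequence[where c = snd]) auto

lemma S_add:
  assumes "x \<in> S" "z \<in> integer_points \<inter> recession"
  shows "x + z \<in> S"
  using assms unfolding S_eq recession_def
  by (force simp: inner_add_right intro: integer_points_add)

lemma recession_scale: "z \<in> recession \<Longrightarrow> t \<ge> 0 \<Longrightarrow> t *\<^sub>R z \<in> recession"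
  by (auto simp: recession_def mult_nonneg_nonpos)

lemma S_add_multiple:
  assumes "x \<in> S" "z \<in> integer_points \<inter> recession"
  shows "x + of_nat k *\<^sub>R z \<in> S"
  using assms by (intro S_add) (auto intro: integer_points_scale recession_scale)

text \<open>Rows vanishing on \<open>r\<close> also vanish on a sufficiently close integer approximation of a multiple
  of \<open>r\<close>, because they take integer values there.\<close>

lemma integer_recession_near_multiple:
  assumes r: "r \<in> recession" and \<epsilon>: "\<epsilon> > 0"
  shows "\<exists>l z. l \<ge> m \<and> z \<in> integer_points \<inter> recession \<and> norm (z - l *\<^sub>R r) < \<epsilon>"
proof -
  let ?A = "fst ` I"
  have fin: "finite ?A" using finite_rows by simp
  \<comment> \<open>Makes every row change by less than 1 between \<open>l *\<^sub>R r\<close> and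
    \<open>z\<close>.\<close>
  define \<delta> where "\<delta> = min \<epsilon> (1 / (1 + (\<Sum>a\<in>?A. norm a)))"
  \<comment> \<open>Makes \<open>l * (a \<bullet> r)\<close> at most \<open>- 1\<close> for every
    row with \<open>a \<bullet> r < 0\<close>; rows with \<open>a \<bullet> r = 0\<close> contribute
    0, since division by 0 yields 0.\<close>
  define m' where "m' = 1 + \<bar>m\<bar> + (\<Sum>a\<in>?A. 1 / \<bar>a \<bullet> r\<bar>)"
  have sum0: "0 \<le> (\<Sum>a\<in>?A. norm a)" "0 \<le> (\<Sum>a\<in>?A. 1 / \<bar>a \<bullet> r\<bar>)" by (simp_all add: sum_nonneg)
  have "\<delta> > 0" "m' > 0" using \<epsilon> sum0 by (auto simp: \<delta>_def m'_def)
  then obtain l z where l: "l \<ge> m'" and z: "z \<in> integer_points" "norm (z - l *\<^sub>R r) < \<delta>"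
    using integer_point_near_multiple[of m' \<delta> r] by blast
  have "a \<bullet> z \<le> 0" if a: "a \<in> ?A" for a
  proof -
    have "norm a \<le> (\<Sum>a\<in>?A. norm a)" using fin a by (intro member_le_sum) auto
    then have "\<delta> \<le> 1 / (1 + norm a)"
      unfolding \<delta>_def by (intro min.coboundedI2 frac_le) (auto simp: add_pos_nonneg)
    then have "norm a * \<delta> \<le> norm a * (1 / (1 + norm a))" by (rule mult_left_mono) simp
    also have "\<dots> < 1" using add_pos_nonneg[of 1 "norm a"] by (simp add: divide_less_eq_1_pos)
    finally have na: "norm a * \<delta> < 1" .
    have "\<bar>a \<bullet> (z - l *\<^sub>R r)\<bar> \<le> norm a * norm (z - l *\<^sub>R r)" by (rule Cauchy_Schwarz_ineq2)
    also have "\<dots> \<le> norm a * \<delta>" using z(2) by (intro mult_left_mono) auto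
    finally have close: "\<bar>a \<bullet> z - l * (a \<bullet> r)\<bar> < 1" using na by (simp add: inner_diff_right)
    have ar: "a \<bullet> r \<le> 0" using r a by (auto simp: recession_def)
    show ?thesis
    proof (cases "a \<bullet> r = 0")
      case True
      moreover have "a \<bullet> z \<in> \<int>" using a z(1) integer_rows by (intro integer_points_inner) auto
      ultimately show ?thesis using close Ints_nonzero_abs_less1 by fastforce
    next
      case False
      have "1 / \<bar>a \<bullet> r\<bar> \<le> (\<Sum>a\<in>?A. 1 / \<bar>a \<bullet> r\<bar>)" by (rule member_le_sum[OF a]) (use fin in auto)
      then have "1 / \<bar>a \<bullet> r\<bar> \<le> l" using l by (simp add: m'_def)
      then have "l * (a \<bullet> r) \<le> - 1" using ar False by (simp add: field_simps)
      then show ?thesis using close by linarith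
    qed
  qed
  moreover have "l \<ge> m" using l sum0 by (simp add: m'_def)
  moreover have "norm (z - l *\<^sub>R r) < \<epsilon>" using z(2) by (simp add: \<delta>_def)
  ultimately show ?thesis using z(1) unfolding recession_def by blast
qed

end

section \<open>The lineality space of a minimal valid function\<close>

locale minimal_sublinear = polyhedral_lattice_set I S
  for I :: "((real ^ 'n) \<times> real) set" and S :: "(real ^ 'n) set" +
  fixes f :: "real ^ 'n" and \<psi> :: "real ^ 'n \<Rightarrow> real"
  assumes valid: "sublinear_valid f S \<psi>"
    and minimal: "\<And>h. sublinear_valid f S h \<Longrightarrow> \<forall>r. h r \<le> \<psi> r \<Longrightarrow> h = \<psi>"
begin

lemma sublinear: "sublinear \<psi>"
  using valid by (simp add: sublinear_valid_def)

lemma ge1: "x \<in> S \<Longrightarrow> \<psi> (x - f) \<ge> 1"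
  using valid by (simp add: sublinear_valid_def)

text \<open>Since \<open>\<psi> w + \<psi> (- w)\<close> is nonnegative, both values are 0: this is
  the lineality space of the body \<open>{x. \<psi> x \<le> 1}\<close>, not the space of all
  directions in which \<psi> is linear.\<close>

definition L :: "(real ^ 'n) set" where
  "L = {w. \<psi> w \<le> 0 \<and> \<psi> (- w) \<le> 0}"

text \<open>Stated for all sublinear functions below \<psi>, because the later approximations of
  \<psi> must be constant modulo \<open>L\<close> too.\<close>

lemma L_invariant:
  assumes h: "sublinear h" "\<forall>r. h r \<le> \<psi> r" and "w \<in> L"
  shows "h (r + w) = h r"
proof (rule sublinear_invariant[OF h(1)])
  show "h w \<le> 0" "h (- w) \<le> 0"
    using assms unfolding L_def by (auto intro: order_trans[OF spec[OF h(2)]])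
qed

lemma subspace_L: "subspace L"
  unfolding subspace_def
proof (intro conjI ballI allI)
  show "0 \<in> L" using sublinear_0[OF sublinear] by (simp add: L_def)
next
  fix x y assume "x \<in> L" "y \<in> L"
  then show "x + y \<in> L"
    using sublinear_add[OF sublinear, of x y] sublinear_add[OF sublinear, of "- x" "- y"]
    by (simp add: L_def)
next
  fix c x assume x: "x \<in> L"
  have "\<psi> (\<bar>c\<bar> *\<^sub>R x) \<le> 0" "\<psi> (- (\<bar>c\<bar> *\<^sub>R x)) \<le> 0"
    using x sublinear_scale[OF sublinear, of "\<bar>c\<bar>" x] sublinear_scale[OF sublinear, of "\<bar>c\<bar>" "- x"]
    by (simp_all add: L_def mult_nonneg_nonpos)
  then show "c *\<^sub>R x \<in> L" by (cases "c \<ge> 0") (simp_all add: L_def)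
qed

text \<open>Replacing \<open>\<psi>\<close> by its infimum along the lines parallel to \<open>d\<close> preserves validity, so by
  minimality \<open>\<psi>\<close> is constant on these lines.\<close>

lemma line_in_L:
  assumes line: "\<And>x t. x \<in> S \<Longrightarrow> \<psi> (x - f + t *\<^sub>R d) \<ge> 1"
  shows "d \<in> L"
proof -
  obtain x0 where x0: "x0 \<in> S" using S_nonempty by blast
  define h where "h r = (INF t. \<psi> (r + t *\<^sub>R d))" for r
  \<comment> \<open>Comparison with the line through one fixed point \<open>x0\<close> bounds \<psi>
    below along every parallel line.\<close>
  have "1 - \<psi> (x0 - f - r) \<le> \<psi> (r + t *\<^sub>R d)" for r t
    using line[OF x0, of t] sublinear_add[OF sublinear, of "x0 - f - r" "r + t *\<^sub>R d"]
    by (simp add: algebra_simps)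
  then have bdd: "bdd_below (range (\<lambda>t. \<psi> (r + t *\<^sub>R d)))" for r
    by (intro bdd_belowI2[of _ "1 - \<psi> (x0 - f - r)"]) auto
  have lower: "h r \<le> \<psi> (r + t *\<^sub>R d)" for r t
    unfolding h_def using bdd by (rule cINF_lower) simp
  have greatest: "m \<le> h r" if "\<And>t. m \<le> \<psi> (r + t *\<^sub>R d)" for r m
    unfolding h_def using that by (intro cINF_greatest) auto
  have "sublinear h"
    unfolding sublinear_def
  proof (intro conjI allI impI)
    fix r s
    have "h (r + s) - \<psi> (r + t *\<^sub>R d) \<le> h s" for t
    proof (rule greatest)
      fix u
      have "h (r + s) \<le> \<psi> (r + s + (t + u) *\<^sub>R d)" by (rule lower)
      also have "r + s + (t + u) *\<^sub>R d = (r + t *\<^sub>R d) + (s + u *\<^sub>R d)" by (simp add: algebra_simps)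
      also have "\<psi> \<dots> \<le> \<psi> (r + t *\<^sub>R d) + \<psi> (s + u *\<^sub>R d)" by (rule sublinear_add[OF sublinear])
      finally show "h (r + s) - \<psi> (r + t *\<^sub>R d) \<le> \<psi> (s + u *\<^sub>R d)" by simp
    qed
    then have "h (r + s) - h s \<le> h r" by (intro greatest) (simp add: algebra_simps)
    then show "h (r + s) \<le> h r + h s" by simp
  next
    fix t :: real and r assume t: "t > 0"
    have "h (t *\<^sub>R r) / t \<le> h r"
    proof (rule greatest)
      fix u
      have "h (t *\<^sub>R r) \<le> \<psi> (t *\<^sub>R r + (t * u) *\<^sub>R d)" by (rule lower)
      also have "\<dots> = t * \<psi> (r + u *\<^sub>R d)"
        using sublinear_scale[OF sublinear, of t "r + u *\<^sub>R d"] t by (simp add: scaleR_add_right)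
      finally show "h (t *\<^sub>R r) / t \<le> \<psi> (r + u *\<^sub>R d)" using t by (simp add: field_simps)
    qed
    then show "h (t *\<^sub>R r) \<le> t * h r" using t by (simp add: field_simps)
  qed
  then have "sublinear_valid f S h"
    using line greatest by (auto simp: sublinear_valid_def)
  moreover have "\<forall>r. h r \<le> \<psi> r" using lower[of _ 0] by simp
  ultimately have "h = \<psi>" by (rule minimal)
  then have "\<psi> r \<le> \<psi> (r + t *\<^sub>R d)" for r t using lower by simp
  from this[of "- d" 1] this[of d "- 1"] show ?thesis
    using sublinear_0[OF sublinear] by (simp add: L_def)
qed

text \<open>An integral recession vector \<open>z\<close> near a distant multiple of
  \<open>r\<close> keeps \<open>x + z\<close> in \<open>S\<close>. From a given point of the line to
  \<open>x + z - f\<close> only a nonnegative multiple of \<open>r\<close>, where \<psi> is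
  nonpositive, and a small error are added; so \<psi> is at least 1 on the whole line.\<close>

lemma recession_nonpos_in_L:
  assumes r: "r \<in> recession" and le: "\<psi> r \<le> 0"
  shows "r \<in> L"
proof (rule line_in_L)
  fix x s assume x: "x \<in> S"
  obtain C where C: "C > 0" "\<And>r. \<psi> r \<le> C * norm r" using sublinear_bound[OF sublinear] by blast
  show "1 \<le> \<psi> (x - f + s *\<^sub>R r)"
  proof (rule field_le_epsilon)
    fix e :: real assume e: "e > 0"
    then have "e / C > 0" using C by simp
    then obtain l z where z: "l \<ge> s" "z \<in> integer_points \<inter> recession" "norm (z - l *\<^sub>R r) < e / C"
      using integer_recession_near_multiple[OF r, of "e / C" s] by blast
    have "1 \<le> \<psi> (x + z - f)" by (rule ge1[OF S_add[OF x z(2)]])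
    also have "x + z - f = (x - f + s *\<^sub>R r) + (l - s) *\<^sub>R r + (z - l *\<^sub>R r)" by (simp add: algebra_simps)
    also have "\<psi> \<dots> \<le> \<psi> ((x - f + s *\<^sub>R r) + (l - s) *\<^sub>R r) + \<psi> (z - l *\<^sub>R r)"
      by (rule sublinear_add[OF sublinear])
    also have "\<psi> ((x - f + s *\<^sub>R r) + (l - s) *\<^sub>R r) \<le> \<psi> (x - f + s *\<^sub>R r) + \<psi> ((l - s) *\<^sub>R r)"
      by (rule sublinear_add[OF sublinear])
    also have "\<psi> ((l - s) *\<^sub>R r) \<le> 0"
      using sublinear_scale[OF sublinear, of "l - s" r] z(1) le by (simp add: mult_nonneg_nonpos)
    also have "\<psi> (z - l *\<^sub>R r) \<le> C * norm (z - l *\<^sub>R r)" by (rule C(2))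
    also have "\<dots> \<le> e" using z(3) C(1) by (simp add: field_simps)
    finally show "1 \<le> \<psi> (x - f + s *\<^sub>R r) + e" by simp
  qed
qed

section \<open>Discreteness modulo the lineality space\<close>

definition proj :: "real ^ 'n \<Rightarrow> real ^ 'n" where
  "proj = (SOME p. linear p \<and> (\<forall>x. x - p x \<in> L) \<and> (\<forall>w\<in>L. p w = 0))"

lemma proj: "linear proj" "x - proj x \<in> L" "w \<in> L \<Longrightarrow> proj w = 0"
  using someI_ex[OF linear_map_with_kernel[OF subspace_L]] unfolding proj_def by blast+

lemma proj_idem: "proj (proj x) = proj x"
  using proj(3)[OF proj(2)[of x]] linear_diff[OF proj(1), of x "proj x"] by simp

lemma proj_eq_imp_diff_in_L:
  assumes "proj x = proj y" shows "x - y \<in> L"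
proof -
  have "x - y = (x - proj x) - (y - proj y)" using assms by simp
  then show ?thesis using subspace_diff[OF subspace_L proj(2) proj(2)] by (simp only:)
qed

lemma proj_invariant:
  assumes "sublinear h" "\<forall>r. h r \<le> \<psi> r"
  shows "h (r + proj x) = h (r + x)"
  using L_invariant[OF assms proj(2), of "r + proj x" x] by (simp add: algebra_simps)

lemmas proj_invariant_0 = proj_invariant[of _ 0, simplified]

text \<open>Ever smaller steps, repeated in both directions, would in the limit force \<psi> to be
  at least 1 on whole lines in some unit direction \<open>d\<close>. Then \<open>d\<close> lies in
  \<open>L\<close> and projects to 0, although as a limit of projected vectors it is fixed by
  \<open>proj\<close>.\<close>

lemma no_small_recession_steps:
  assumes z: "\<And>i. z i \<in> integer_points \<inter> recession" and ne: "\<And>i. proj (z i) \<noteq> 0"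
    and lim: "(\<lambda>i. proj (z i)) \<longlonglongrightarrow> 0"
  shows False
proof -
  obtain C where C: "C > 0" "\<And>r. \<psi> r \<le> C * norm r" using sublinear_bound[OF sublinear] by blast
  have "a \<bullet> z i \<le> 0" if "(a, b) \<in> I" for a b i using z[of i] that by (force simp: recession_def)
  then obtain \<phi> :: "nat \<Rightarrow> nat" where \<phi>: "strict_mono \<phi>"
    and diff: "\<And>i j. i \<le> j \<Longrightarrow> z (\<phi> j) - z (\<phi> i) \<in> integer_points \<inter> recession"
    using lattice_decseq_subsequence[of z "\<lambda>_. 0"] z by blast
  define y where "y i = z (\<phi> i)" for i
  have ylim: "(\<lambda>i. proj (y i)) \<longlonglongrightarrow> 0"
    using LIMSEQ_subseq_LIMSEQ[OF lim \<phi>] by (simp add: y_def comp_def)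
  have fwd: "1 \<le> \<psi> (x - f + of_nat k *\<^sub>R y i)" if "x \<in> S" for x k i
    using ge1[OF S_add_multiple[OF that z]] by (simp add: y_def algebra_simps)
  \<comment> \<open>Backward steps are imitated by adding multiples of \<open>y j - y i\<close>, an
    integral recession vector, where \<open>y j\<close> is negligible modulo \<open>L\<close> for
    large \<open>j\<close>.\<close>
  have bwd: "1 \<le> \<psi> (x - f - of_nat k *\<^sub>R y i)" if x: "x \<in> S" for x k i
  proof (rule tendsto_le[OF sequentially_bot _ tendsto_const])
    let ?g = "\<lambda>j. \<psi> (x - f - of_nat k *\<^sub>R y i) + C * norm (of_nat k *\<^sub>R proj (y j))"
    have "(\<lambda>j. C * norm (of_nat k *\<^sub>R proj (y j))) \<longlonglongrightarrow> C * norm (of_nat k *\<^sub>R (0 :: real ^ 'n))"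
      by (intro tendsto_intros ylim)
    then have "(\<lambda>j. C * norm (of_nat k *\<^sub>R proj (y j))) \<longlonglongrightarrow> 0" by simp
    from tendsto_add[OF tendsto_const this] show "?g \<longlonglongrightarrow> \<psi> (x - f - of_nat k *\<^sub>R y i)" by simp
    have "1 \<le> ?g j" if "j \<ge> i" for j
    proof -
      have "1 \<le> \<psi> (x + of_nat k *\<^sub>R (y j - y i) - f)"
        using diff[OF that] by (intro ge1 S_add_multiple x) (simp add: y_def)
      also have "x + of_nat k *\<^sub>R (y j - y i) - f = (x - f - of_nat k *\<^sub>R y i) + of_nat k *\<^sub>R y j"
        by (simp add: algebra_simps)
      also have "\<psi> \<dots> = \<psi> ((x - f - of_nat k *\<^sub>R y i) + proj (of_nat k *\<^sub>R y j))"
        using proj_invariant[OF sublinear] by simp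
      also have "\<dots> \<le> \<psi> (x - f - of_nat k *\<^sub>R y i) + \<psi> (of_nat k *\<^sub>R proj (y j))"
        using sublinear_add[OF sublinear] by (simp add: linear_scale[OF proj(1)])
      also have "\<psi> (of_nat k *\<^sub>R proj (y j)) \<le> C * norm (of_nat k *\<^sub>R proj (y j))" by (rule C(2))
      finally show ?thesis by simp
    qed
    then show "\<forall>\<^sub>F j in sequentially. 1 \<le> ?g j" by (auto simp: eventually_sequentially)
  qed
  have int: "1 \<le> \<psi> (x - f + of_int k *\<^sub>R proj (y i))" if "x \<in> S" for x k i
  proof -
    have "\<psi> (x - f + of_int k *\<^sub>R proj (y i)) = \<psi> (x - f + of_int k *\<^sub>R y i)"
      using proj_invariant[OF sublinear, of "x - f" "of_int k *\<^sub>R y i"]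
      by (simp add: linear_scale[OF proj(1)])
    moreover have "1 \<le> \<psi> (x - f + of_int k *\<^sub>R y i)"
      using fwd[OF that, of "nat k" i] bwd[OF that, of "nat (- k)" i] by (cases "k \<ge> 0") auto
    ultimately show ?thesis by simp
  qed
  define e where "e i = (1 / norm (proj (y i))) *\<^sub>R proj (y i)" for i
  have ne': "proj (y i) \<noteq> 0" for i using ne by (simp add: y_def)
  have "e i \<in> sphere 0 1" for i using ne'[of i] by (simp add: e_def)
  then obtain d \<rho> where d: "d \<in> sphere 0 1" and \<rho>: "strict_mono \<rho>" and elim: "(e \<circ> \<rho>) \<longlonglongrightarrow> d"
    using compact_sphere[of "0 :: real ^ 'n" 1] unfolding compact_def by metis
  have "d \<in> L"
  proof (rule line_in_L)
    fix x t assume x: "x \<in> S"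
    \<comment> \<open>So many steps come within one step length of \<open>t\<close>, and the step
      length tends to 0.\<close>
    define k where "k i = \<lfloor>t / norm (proj (y i))\<rfloor>" for i
    let ?g = "\<lambda>i. \<psi> (x - f + t *\<^sub>R d) + C * (norm (proj (y (\<rho> i))) + \<bar>t\<bar> * norm (e (\<rho> i) - d))"
    show "1 \<le> \<psi> (x - f + t *\<^sub>R d)"
    proof (rule tendsto_le[OF sequentially_bot _ tendsto_const])
      have "(\<lambda>i. proj (y (\<rho> i))) \<longlonglongrightarrow> 0"
        using LIMSEQ_subseq_LIMSEQ[OF ylim \<rho>] by (simp add: comp_def)
      moreover have "(\<lambda>i. e (\<rho> i) - d) \<longlonglongrightarrow> 0"
        using elim by (simp add: comp_def LIM_zero_iff)
      ultimately have "?g \<longlonglongrightarrow> \<psi> (x - f + t *\<^sub>R d) + C * (norm (0 :: real ^ 'n) + \<bar>t\<bar> * norm (0 :: real ^ 'n))"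
        by (intro tendsto_intros)
      then show "?g \<longlonglongrightarrow> \<psi> (x - f + t *\<^sub>R d)" by simp
      have "1 \<le> ?g i" for i
      proof -
        let ?w = "proj (y (\<rho> i))" and ?k = "k (\<rho> i)"
        have w: "norm ?w > 0" "?w = norm ?w *\<^sub>R e (\<rho> i)" using ne' by (simp_all add: e_def)
        have "\<bar>of_int ?k - t / norm ?w\<bar> \<le> 1" unfolding k_def by linarith
        then have "\<bar>of_int ?k - t / norm ?w\<bar> * norm ?w \<le> 1 * norm ?w" by (intro mult_right_mono) auto
        moreover have "of_int ?k * norm ?w - t = (of_int ?k - t / norm ?w) * norm ?w"
          using w(1) by (simp add: field_simps)
        ultimately have kt: "\<bar>of_int ?k * norm ?w - t\<bar> \<le> norm ?w" by (simp add: abs_mult)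
        have "of_int ?k *\<^sub>R ?w - t *\<^sub>R d = (of_int ?k * norm ?w - t) *\<^sub>R e (\<rho> i) + t *\<^sub>R (e (\<rho> i) - d)"
          by (subst (1) w(2)) (simp add: algebra_simps)
        also have "norm \<dots> \<le> norm ((of_int ?k * norm ?w - t) *\<^sub>R e (\<rho> i)) + norm (t *\<^sub>R (e (\<rho> i) - d))"
          by (rule norm_triangle_ineq)
        also have "\<dots> \<le> norm ?w + \<bar>t\<bar> * norm (e (\<rho> i) - d)" using kt w(1) by (simp add: e_def)
        finally have n: "norm (of_int ?k *\<^sub>R ?w - t *\<^sub>R d) \<le> norm ?w + \<bar>t\<bar> * norm (e (\<rho> i) - d)" .
        have "1 \<le> \<psi> (x - f + of_int ?k *\<^sub>R ?w)" by (rule int[OF x])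
        also have "x - f + of_int ?k *\<^sub>R ?w = (x - f + t *\<^sub>R d) + (of_int ?k *\<^sub>R ?w - t *\<^sub>R d)" by simp
        also have "\<psi> \<dots> \<le> \<psi> (x - f + t *\<^sub>R d) + \<psi> (of_int ?k *\<^sub>R ?w - t *\<^sub>R d)"
          by (rule sublinear_add[OF sublinear])
        also have "\<psi> (of_int ?k *\<^sub>R ?w - t *\<^sub>R d) \<le> C * norm (of_int ?k *\<^sub>R ?w - t *\<^sub>R d)" by (rule C(2))
        also have "\<dots> \<le> C * (norm ?w + \<bar>t\<bar> * norm (e (\<rho> i) - d))"
          using n C(1) by (intro mult_left_mono) auto
        finally show ?thesis by simp
      qed
      then show "\<forall>\<^sub>F i in sequentially. 1 \<le> ?g i" by simp
    qed
  qed
  then have "proj d = 0" by (rule proj(3))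
  moreover have "proj d = d"
  proof -
    have "isCont proj d" using proj(1) by (rule linear_continuous_at[OF linear_conv_bounded_linear[THEN iffD1]])
    then have "(\<lambda>i. proj ((e \<circ> \<rho>) i)) \<longlonglongrightarrow> proj d" using elim by (rule isCont_tendsto_compose)
    moreover have "proj ((e \<circ> \<rho>) i) = (e \<circ> \<rho>) i" for i
      by (simp add: e_def linear_scale[OF proj(1)] proj_idem)
    ultimately have "(e \<circ> \<rho>) \<longlonglongrightarrow> proj d" by (simp only:)
    then show ?thesis using elim by (rule LIMSEQ_unique)
  qed
  ultimately show False using d by simp
qed

text \<open>Infinitely many projections in a bounded set contain a convergent sequence of distinct
  points. Thinned so that differences are recession vectors, its consecutive differences contradict
  \<open>no_small_recession_steps\<close>.\<close>

lemma finite_proj_if_bounded: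
  assumes X: "X \<subseteq> S" and bd: "bounded (proj ` X)"
  shows "finite (proj ` X)"
proof (rule ccontr)
  assume "infinite (proj ` X)"
  then obtain v :: "nat \<Rightarrow> real ^ 'n" where v: "inj v" "range v \<subseteq> proj ` X"
    using infinite_countable_subset by blast
  then have "\<forall>i. \<exists>x. x \<in> X \<and> v i = proj x" by blast
  then obtain u where u: "\<And>i. u i \<in> X" "\<And>i. v i = proj (u i)" by metis
  have "\<forall>i. v i \<in> closure (proj ` X)" using v(2) closure_subset by blast
  moreover have "compact (closure (proj ` X))" using bd by simp
  ultimately obtain l \<rho> where \<rho>: "strict_mono (\<rho> :: nat \<Rightarrow> nat)" "(v \<circ> \<rho>) \<longlonglongrightarrow> l"
    unfolding compact_def by metis
  obtain \<phi> :: "nat \<Rightarrow> nat" where \<phi>: "strict_mono \<phi>"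
    and diff: "\<And>i j. i \<le> j \<Longrightarrow> u (\<rho> (\<phi> j)) - u (\<rho> (\<phi> i)) \<in> integer_points \<inter> recession"
    using S_decseq_subsequence[of "\<lambda>i. u (\<rho> i)"] u(1) X by blast
  define w where "w i = u (\<rho> (\<phi> i))" for i :: nat
  have wlim: "(\<lambda>i. proj (w i)) \<longlonglongrightarrow> l"
    using LIMSEQ_subseq_LIMSEQ[OF \<rho>(2) \<phi>] by (simp add: w_def u(2) comp_def)
  show False
  proof (rule no_small_recession_steps)
    show "w (Suc i) - w i \<in> integer_points \<inter> recession" for i
      unfolding w_def by (intro diff) simp
    show "proj (w (Suc i) - w i) \<noteq> 0" for i
    proof -
      have "\<rho> (\<phi> (Suc i)) \<noteq> \<rho> (\<phi> i)"
        using \<rho>(1) \<phi> by (simp add: strict_mono_eq)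
      then have "v (\<rho> (\<phi> (Suc i))) \<noteq> v (\<rho> (\<phi> i))" using v(1) by (simp add: inj_eq)
      then show ?thesis by (simp add: w_def u(2) linear_diff[OF proj(1)])
    qed
    show "(\<lambda>i. proj (w (Suc i) - w i)) \<longlonglongrightarrow> 0"
      using tendsto_diff[OF LIMSEQ_Suc[OF wlim] wlim] by (simp add: linear_diff[OF proj(1)])
  qed
qed

text \<open>Normalised recession directions modulo \<open>L\<close>: positivity on this compact set
  controls the growth far out in \<open>S\<close>.\<close>

definition D :: "(real ^ 'n) set" where
  "D = proj ` recession \<inter> sphere 0 1"

lemma compact_D: "compact D"
proof -
  have "closed (proj ` recession)"
    unfolding recession_def using finite_rows proj(1) by (intro closed_linear_image_polyhedral_cone) auto
  then show ?thesis unfolding D_def by (intro closed_Int_compact) auto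
qed

lemma pos_on_D:
  assumes "d \<in> D" shows "\<psi> d > 0"
proof (rule ccontr)
  assume "\<not> \<psi> d > 0"
  moreover obtain r where r: "r \<in> recession" "d = proj r" using assms by (auto simp: D_def)
  moreover have "\<psi> (proj r) = \<psi> r" using proj_invariant_0[OF sublinear] by simp
  ultimately have "proj r = 0" by (intro proj(3) recession_nonpos_in_L) auto
  then show False using assms r by (simp add: D_def)
qed

text \<open>On recession vectors \<open>h\<close> grows at least like \<open>m\<close> times the
  projected length. An unbounded sequence has a subsequence whose differences from its first term
  are recession vectors, against the bound on \<open>h\<close>.\<close>

lemma finite_proj_sublevel:
  assumes h: "sublinear h" "\<forall>r. h r \<le> \<psi> r" and m: "m > 0" "\<And>d. d \<in> D \<Longrightarrow> h d \<ge> m"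
  shows "finite (proj ` {x \<in> S. h (x - f) \<le> 1})"
proof (rule finite_proj_if_bounded)
  let ?X = "{x \<in> S. h (x - f) \<le> 1}"
  have growth: "m * norm (proj z) \<le> h z" if z: "z \<in> recession" for z
  proof (cases "proj z = 0")
    case True
    then show ?thesis using proj_invariant_0[OF h, of z] sublinear_0[OF h(1)] by simp
  next
    case False
    let ?c = "1 / norm (proj z)"
    have "proj (?c *\<^sub>R z) \<in> proj ` recession" by (intro imageI recession_scale[OF z]) simp
    moreover have "norm (proj (?c *\<^sub>R z)) = 1" using False by (simp add: linear_scale[OF proj(1)])
    ultimately have "proj (?c *\<^sub>R z) \<in> D" by (simp add: D_def)
    then have "m \<le> h (proj (?c *\<^sub>R z))" by (rule m(2))
    also have "\<dots> = ?c * h z"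
      using proj_invariant_0[OF h] sublinear_scale[OF h(1), of ?c z] by simp
    finally show ?thesis using False by (simp add: field_simps)
  qed
  show "bounded (proj ` ?X)"
  proof (rule ccontr)
    assume "\<not> bounded (proj ` ?X)"
    then have "\<forall>i::nat. \<exists>x. x \<in> ?X \<and> norm (proj x) > real i"
      unfolding bounded_iff by (auto simp: not_le)
    from choice[OF this] obtain u where u: "\<And>i::nat. u i \<in> ?X \<and> norm (proj (u i)) > real i" by blast
    then have uS: "u i \<in> S" and uh: "h (u i - f) \<le> 1" and un: "norm (proj (u i)) > real i" for i
      by simp_all
    obtain \<phi> :: "nat \<Rightarrow> nat" where \<phi>: "strict_mono \<phi>"
      and diff: "\<And>i j. i \<le> j \<Longrightarrow> u (\<phi> j) - u (\<phi> i) \<in> integer_points \<inter> recession"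
      using S_decseq_subsequence[of u] uS by blast
    define u0 where "u0 = u (\<phi> 0)"
    define c where "c = 1 + h (f - u0)"
    have "real j \<le> norm (proj u0) + c / m" for j
    proof -
      let ?z = "u (\<phi> j) - u0"
      have "m * norm (proj ?z) \<le> h ?z" using diff[of 0 j] by (intro growth) (simp add: u0_def)
      also have "\<dots> \<le> h (u (\<phi> j) - f) + h (f - u0)"
        using sublinear_add[OF h(1), of "u (\<phi> j) - f" "f - u0"] by simp
      also have "\<dots> \<le> c" using uh[of "\<phi> j"] by (simp add: c_def)
      finally have "norm (proj ?z) \<le> c / m" using m(1) by (simp add: field_simps)
      moreover have "norm (proj (u (\<phi> j))) \<le> norm (proj u0) + norm (proj ?z)"
        using norm_triangle_ineq[of "proj u0" "proj ?z"] by (simp add: linear_diff[OF proj(1)])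
      moreover have "real j \<le> real (\<phi> j)" using seq_suble[OF \<phi>] by simp
      ultimately show ?thesis using un[of "\<phi> j"] by linarith
    qed
    then show False using reals_Archimedean2[of "norm (proj u0) + c / m"] by (meson not_le)
  qed
qed blast

end

section \<open>Minimal valid functions are piecewise linear\<close>

context minimal_sublinear
begin

definition subgradients :: "(real ^ 'n) set" where
  "subgradients = {a. \<forall>r. a \<bullet> r \<le> \<psi> r}"

lemma subgradient_zero_on_L:
  assumes "a \<in> subgradients" "w \<in> L" shows "a \<bullet> w = 0"
proof -
  have "a \<bullet> w \<le> \<psi> w" "a \<bullet> (- w) \<le> \<psi> (- w)" using assms unfolding subgradients_def by blast+
  then show ?thesis using assms(2) by (simp add: L_def)
qed

lemma support_max_le_psi:
  assumes "finite A" "A \<noteq> {}" "A \<subseteq> subgradients"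
  shows "\<forall>r. support_max A r \<le> \<psi> r"
  using assms by (auto simp: support_max_le_iff subgradients_def)

lemma support_max_eq_psi:
  assumes A: "finite A" "A \<noteq> {}" "A \<subseteq> subgradients"
    and "\<And>x. x \<in> S \<Longrightarrow> support_max A (x - f) \<ge> 1"
  shows "support_max A = \<psi>"
  using assms sublinear_support_max[OF A(1,2)] support_max_le_psi[OF A]
  by (intro minimal) (auto simp: sublinear_valid_def)

lemma lower_bound_on_D:
  assumes h: "sublinear h" and pos: "\<And>d. d \<in> D \<Longrightarrow> h d > 0"
  shows "\<exists>m>0. \<forall>d\<in>D. m \<le> h d"
proof (cases "D = {}")
  case False
  then obtain d where "d \<in> D" "\<forall>d'\<in>D. h d \<le> h d'"
    using continuous_attains_inf[OF compact_D _ sublinear_continuous[OF h]] by blast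
  then show ?thesis using pos by blast
qed (auto intro: exI[of _ 1])

text \<open>By compactness of \<open>D\<close>, finitely many subgradients have a positive maximum
  on \<open>D\<close>, so modulo \<open>L\<close> only finitely many points of \<open>S\<close> give
  them a maximum of at most 1. One more subgradient for each such class restores validity.\<close>

lemma polyhedral:
  "\<exists>A. finite A \<and> A \<noteq> {} \<and> support_max A = \<psi>"
proof -
  have sg: "\<exists>a\<in>subgradients. a \<bullet> y = \<psi> y" if "\<psi> y > 0" for y
    using sublinear_subgradient[OF sublinear that] unfolding subgradients_def by blast
  have "D \<subseteq> (\<Union>a\<in>subgradients. {x. a \<bullet> x > 0})"
  proof
    fix d assume "d \<in> D"
    then have "\<psi> d > 0" by (rule pos_on_D)
    then show "d \<in> (\<Union>a\<in>subgradients. {x. a \<bullet> x > 0})" using sg[of d] by force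
  qed
  then obtain T where T: "T \<subseteq> subgradients" "finite T" "D \<subseteq> (\<Union>a\<in>T. {x. a \<bullet> x > 0})"
    by (rule compactE_image[OF compact_D, of subgradients "\<lambda>a. {x. a \<bullet> x > 0}", rotated])
      (simp_all add: open_halfspace_gt)
  obtain x0 where x0: "x0 \<in> S" using S_nonempty by blast
  \<comment> \<open>Keeps \<open>A1\<close> nonempty even if the cover \<open>T\<close> is empty, as
    can happen for empty \<open>D\<close>.\<close>
  obtain a0 where a0: "a0 \<in> subgradients" using sg[of "x0 - f"] ge1[OF x0] by force
  define A1 where "A1 = insert a0 T"
  have A1: "finite A1" "A1 \<noteq> {}" "A1 \<subseteq> subgradients" using T a0 by (auto simp: A1_def)
  have "support_max A1 d > 0" if "d \<in> D" for d
  proof -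
    obtain a where "a \<in> T" "a \<bullet> d > 0" using T(3) \<open>d \<in> D\<close> by blast
    then show ?thesis using support_max_ge[OF A1(1), of a d] by (simp add: A1_def)
  qed
  then obtain m where m: "m > 0" "\<forall>d\<in>D. m \<le> support_max A1 d"
    using lower_bound_on_D[OF sublinear_support_max[OF A1(1,2)]] by blast
  define Y where "Y = proj ` {x \<in> S. support_max A1 (x - f) \<le> 1}"
  have finY: "finite Y"
    unfolding Y_def using m
    by (intro finite_proj_sublevel[OF sublinear_support_max[OF A1(1,2)] support_max_le_psi[OF A1]]) auto
  \<comment> \<open>Subgradients vanish on \<open>L\<close>, so one of them serves a whole class
    modulo \<open>L\<close>.\<close>
  have "\<exists>a. a \<in> subgradients \<and> (\<forall>x\<in>S. proj x = y \<longrightarrow> a \<bullet> (x - f) \<ge> 1)" if "y \<in> Y" for y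
  proof -
    obtain z where z: "z \<in> S" "y = proj z" using \<open>y \<in> Y\<close> by (auto simp: Y_def)
    obtain a where a: "a \<in> subgradients" "a \<bullet> (z - f) = \<psi> (z - f)"
      using sg[of "z - f"] ge1[OF z(1)] by force
    have "a \<bullet> (x - f) \<ge> 1" if "x \<in> S" "proj x = y" for x
    proof -
      have "a \<bullet> (x - z) = 0"
        using proj_eq_imp_diff_in_L[of x z] that(2) z(2) by (intro subgradient_zero_on_L[OF a(1)]) simp
      then have "a \<bullet> (x - f) = a \<bullet> (z - f)" by (simp add: inner_diff_right)
      then show ?thesis using a(2) ge1[OF z(1)] by simp
    qed
    then show ?thesis using a(1) by blast
  qed
  then obtain c where c: "\<And>y. y \<in> Y \<Longrightarrow> c y \<in> subgradients"
    "\<And>y x. y \<in> Y \<Longrightarrow> x \<in> S \<Longrightarrow> proj x = y \<Longrightarrow> c y \<bullet> (x - f) \<ge> 1" by metis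
  define A where "A = A1 \<union> c ` Y"
  have A: "finite A" "A \<noteq> {}" "A \<subseteq> subgradients"
    using A1 finY c(1) by (auto simp: A_def)
  have "support_max A (x - f) \<ge> 1" if x: "x \<in> S" for x
  proof (cases "support_max A1 (x - f) \<le> 1")
    case True
    then have "proj x \<in> Y" using x by (auto simp: Y_def)
    then have "c (proj x) \<in> A" "c (proj x) \<bullet> (x - f) \<ge> 1" using c(2) x by (auto simp: A_def)
    then show ?thesis using support_max_ge[OF A(1)] order_trans by blast
  next
    case False
    have "support_max A1 (x - f) \<le> support_max A (x - f)"
      using A1(2) A(1) by (intro support_max_mono) (auto simp: A_def)
    then show ?thesis using False by linarith
  qed
  then show ?thesis using support_max_eq_psi[OF A] A by blast
qed

text \<open>If \<open>a\<close> has no such point, then \<open>a\<close> can be moved a little towards another element of \<open>A\<close>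
  without losing validity: modulo \<open>L\<close> only finitely many points of \<open>S\<close> can be violated.\<close>

lemma facet_point:
  assumes A: "finite A" "support_max A = \<psi>" and a: "a \<in> A"
    and least: "\<And>A'. finite A' \<Longrightarrow> A' \<noteq> {} \<Longrightarrow> support_max A' = \<psi> \<Longrightarrow> card A \<le> card A'"
    and f: "f \<in> convex hull S"
  shows "\<exists>x\<in>S. a \<bullet> (x - f) = 1 \<and> (\<forall>b\<in>A - {a}. b \<bullet> (x - f) < 1)"
proof (rule ccontr)
  assume "\<not> ?thesis"
  then have nofacet: "\<And>x. x \<in> S \<Longrightarrow> a \<bullet> (x - f) = 1 \<Longrightarrow> \<exists>b\<in>A - {a}. b \<bullet> (x - f) \<ge> 1"
    by (meson not_less)
  have Ane: "A \<noteq> {}" using a by blast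
  have Ale: "b \<bullet> r \<le> \<psi> r" if "b \<in> A" for b r
    using support_max_ge[OF A(1) that, of r] A(2) by simp
  \<comment> \<open>With \<open>a\<close> alone, \<open>S\<close> would lie in the half-space
    \<open>a \<bullet> (x - f) \<ge> 1\<close>, which excludes \<open>f\<close> from the convex
    hull.\<close>
  have "A - {a} \<noteq> {}"
  proof
    assume "A - {a} = {}"
    then have "A = {a}" using a by blast
    then have "\<psi> r = a \<bullet> r" for r using A(2) by (auto simp: support_max_def)
    then have "S \<subseteq> {x. a \<bullet> x \<ge> 1 + a \<bullet> f}" using ge1 by (force simp: inner_diff_right)
    then have "convex hull S \<subseteq> {x. a \<bullet> x \<ge> 1 + a \<bullet> f}"
      by (rule hull_minimal) (rule convex_halfspace_ge)
    then show False using f by auto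
  qed
  then obtain c where c: "c \<in> A" "c \<noteq> a" by blast
  \<comment> \<open>Without a direction in which \<open>a\<close> is the strict maximum,
    \<open>a\<close> would be redundant, against the smallest cardinality of
    \<open>A\<close>.\<close>
  obtain r where r: "\<And>b. b \<in> A - {a} \<Longrightarrow> b \<bullet> r < a \<bullet> r"
  proof (rule ccontr)
    assume "\<not> thesis"
    then have red: "\<exists>b\<in>A - {a}. a \<bullet> r \<le> b \<bullet> r" for r using that by (meson not_less)
    have A': "finite (A - {a})" "A - {a} \<noteq> {}" using A(1) c by auto
    have "support_max (A - {a}) r = \<psi> r" for r
    proof (rule antisym)
      show "support_max (A - {a}) r \<le> \<psi> r" using Ale by (simp add: support_max_le_iff[OF A'])
      have "b \<bullet> r \<le> support_max (A - {a}) r" if "b \<in> A" for b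
        using red[of r] support_max_ge[OF A'(1), of _ r] that by (cases "b = a") (auto intro: order_trans)
      then have "support_max A r \<le> support_max (A - {a}) r"
        by (simp add: support_max_le_iff[OF A(1) Ane])
      then show "\<psi> r \<le> support_max (A - {a}) r" using A(2) by simp
    qed
    then have "card A \<le> card (A - {a})" by (intro least[OF A'] ext)
    moreover have "card (A - {a}) < card A" using A(1) a by (rule card_Diff1_less)
    ultimately show False by simp
  qed
  \<comment> \<open>The perturbation: \<open>a\<close> slides towards \<open>c\<close>, and by
    convexity \<open>h e\<close> stays below \<psi> for \<open>e\<close> between 0 and 1.\<close>
  define p where "p e = a + e *\<^sub>R (c - a)" for e :: real
  define h where "h e = support_max (insert (p e) (A - {a}))" for e
  have p: "p e \<bullet> r = a \<bullet> r + e * (c \<bullet> r - a \<bullet> r)" for e r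
    by (simp add: p_def inner_add_left inner_diff_left)
  have fin: "finite (insert (p e) (A - {a}))" and ne: "insert (p e) (A - {a}) \<noteq> {}" for e
    using A(1) by simp_all
  have hsub: "sublinear (h e)" for e unfolding h_def by (rule sublinear_support_max[OF fin ne])
  have hp: "p e \<bullet> r \<le> h e r" and hA: "b \<in> A - {a} \<Longrightarrow> b \<bullet> r \<le> h e r" for e b r
    unfolding h_def by (rule support_max_ge[OF fin], simp)+
  have sub: "insert (p e) (A - {a}) \<subseteq> subgradients" if "0 \<le> e" "e \<le> 1" for e
  proof -
    have "p e \<bullet> r \<le> \<psi> r" for r
    proof -
      have "p e \<bullet> r = (1 - e) * (a \<bullet> r) + e * (c \<bullet> r)" by (simp add: p algebra_simps)
      also have "\<dots> \<le> (1 - e) * \<psi> r + e * \<psi> r"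
        using that Ale a c by (intro add_mono mult_left_mono) auto
      finally show ?thesis by (simp add: algebra_simps)
    qed
    then show ?thesis using Ale by (auto simp: subgradients_def)
  qed
  have hle: "\<forall>r. h e r \<le> \<psi> r" if "0 \<le> e" "e \<le> 1" for e
    unfolding h_def by (rule support_max_le_psi[OF fin ne sub[OF that]])
  \<comment> \<open>Points of \<open>S\<close> that are safe for \<open>e0\<close> are thereby safe
    for all smaller perturbations. Where sliding towards \<open>c\<close> raises the value at
    \<open>r\<close>, the bound comes from \<open>c\<close>, which is still present.\<close>
  have hmono: "h e' r \<le> h e r" if e: "0 \<le> e" "e \<le> e'" "e' \<le> 1" for e e' r
  proof -
    have "p e' \<bullet> r \<le> h e r"
    proof (cases "a \<bullet> r \<le> c \<bullet> r")
      case True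
      then have "e' * (c \<bullet> r - a \<bullet> r) \<le> 1 * (c \<bullet> r - a \<bullet> r)" using e by (intro mult_right_mono) auto
      then have "p e' \<bullet> r \<le> c \<bullet> r" by (simp add: p)
      also have "\<dots> \<le> h e r" using c by (intro hA) auto
      finally show ?thesis .
    next
      case False
      then have "e' * (c \<bullet> r - a \<bullet> r) \<le> e * (c \<bullet> r - a \<bullet> r)" using e by (intro mult_right_mono_neg) auto
      then have "p e' \<bullet> r \<le> p e \<bullet> r" by (simp add: p)
      then show ?thesis using hp order_trans by blast
    qed
    then show ?thesis unfolding h_def[of e'] using hA by (simp add: support_max_le_iff[OF fin ne])
  qed
  obtain m where m: "m > 0" "\<And>d. d \<in> D \<Longrightarrow> m \<le> \<psi> d"
    using lower_bound_on_D[OF sublinear pos_on_D] by blast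
  define N where "N = norm (c - a) + 1"
  \<comment> \<open>On unit vectors the perturbation costs at most \<open>m / 2\<close>, so a
    positive lower bound on \<open>D\<close> survives.\<close>
  define e0 where "e0 = min 1 (m / (2 * N))"
  have nca: "N > 0" by (simp add: N_def add_nonneg_pos)
  have e0: "0 < e0" "e0 \<le> 1" using m nca by (simp_all add: e0_def)
  have e0n: "e0 * norm (c - a) \<le> m / 2"
  proof -
    have "e0 * norm (c - a) \<le> e0 * N" using e0 by (intro mult_left_mono) (auto simp: N_def)
    also have "\<dots> \<le> (m / (2 * N)) * N"
      using nca by (intro mult_right_mono) (auto simp: e0_def)
    also have "\<dots> = m / 2" using nca by simp
    finally show ?thesis .
  qed
  have hD: "m / 2 \<le> h e0 d" if d: "d \<in> D" for d
  proof -
    obtain b where b: "b \<in> A" "\<psi> d = b \<bullet> d" using support_max_attained[OF A(1) Ane, of d] A(2) by metis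
    show ?thesis
    proof (cases "b = a")
      case True
      have "norm d = 1" using d by (simp add: D_def)
      then have "\<bar>(c - a) \<bullet> d\<bar> \<le> norm (c - a)" using Cauchy_Schwarz_ineq2[of "c - a" d] by simp
      then have "e0 * - norm (c - a) \<le> e0 * ((c - a) \<bullet> d)" using e0 by (intro mult_left_mono) auto
      then have "\<psi> d - m / 2 \<le> p e0 \<bullet> d" using e0n b(2) True by (simp add: p inner_diff_left)
      then show ?thesis using m(2)[OF d] hp[of e0 d] by linarith
    next
      case False
      then show ?thesis using hA[of b d e0] b m(1) m(2)[OF d] by simp
    qed
  qed
  define Y where "Y = proj ` {x \<in> S. h e0 (x - f) \<le> 1}"
  have finY: "finite Y"
    unfolding Y_def using m(1) hD e0 by (intro finite_proj_sublevel[OF hsub hle, of _ "m/2"]) auto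
  \<comment> \<open>Either another element already reaches 1 at \<open>x\<close>, or the assumed
    lack of a facet point leaves \<open>a\<close> strictly above 1, and this slack tolerates a small
    perturbation.\<close>
  have small: "\<exists>e1>0. \<forall>e. 0 < e \<and> e \<le> e1 \<longrightarrow> 1 \<le> h e (x - f)" if x: "x \<in> S" for x
  proof (cases "\<exists>b\<in>A - {a}. 1 \<le> b \<bullet> (x - f)")
    case True
    then have "1 \<le> h e (x - f)" for e using hA order_trans by blast
    then show ?thesis by (intro exI[of _ 1]) simp
  next
    case False
    obtain b where "b \<in> A" "\<psi> (x - f) = b \<bullet> (x - f)"
      using support_max_attained[OF A(1) Ane, of "x - f"] A(2) by metis
    then have "1 \<le> a \<bullet> (x - f)" using False ge1[OF x] by (cases "b = a") auto
    then have g: "1 < a \<bullet> (x - f)" using nofacet[OF x] False by (metis order_le_less)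
    define K where "K = \<bar>c \<bullet> (x - f) - a \<bullet> (x - f)\<bar> + 1"
    have K: "K > 0" by (simp add: K_def add_nonneg_pos)
    have "1 \<le> h e (x - f)" if e: "0 < e" "e \<le> (a \<bullet> (x - f) - 1) / K" for e
    proof -
      have "e * - K \<le> e * (c \<bullet> (x - f) - a \<bullet> (x - f))"
        using e by (intro mult_left_mono) (auto simp: K_def)
      moreover have "e * K \<le> a \<bullet> (x - f) - 1" using e K by (simp add: field_simps)
      ultimately have "1 \<le> p e \<bullet> (x - f)" by (simp add: p)
      then show ?thesis using hp order_trans by blast
    qed
    moreover have "(a \<bullet> (x - f) - 1) / K > 0" using g K by simp
    ultimately show ?thesis by blast
  qed
  have "\<exists>e1>0. \<forall>x\<in>S. \<forall>e. proj x = y \<and> 0 < e \<and> e \<le> e1 \<and> e \<le> e0 \<longrightarrow> 1 \<le> h e (x - f)" if "y \<in> Y" for y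
  proof -
    obtain z where z: "z \<in> S" "y = proj z" using \<open>y \<in> Y\<close> by (auto simp: Y_def)
    obtain e1 where e1: "e1 > 0" "\<And>e. 0 < e \<Longrightarrow> e \<le> e1 \<Longrightarrow> 1 \<le> h e (z - f)"
      using small[OF z(1)] by blast
    have "1 \<le> h e (x - f)" if x: "x \<in> S" "proj x = y" and e: "0 < e" "e \<le> e1" "e \<le> e0" for x e
    proof -
      have "x - z \<in> L" using proj_eq_imp_diff_in_L x(2) z(2) by simp
      moreover have "\<forall>r. h e r \<le> \<psi> r" using e e0(2) by (intro hle) auto
      ultimately have "h e ((z - f) + (x - z)) = h e (z - f)" by (intro L_invariant[OF hsub])
      then show ?thesis using e1(2) e by simp
    qed
    then show ?thesis using e1(1) by blast
  qed
  then obtain E where E: "\<And>y. y \<in> Y \<Longrightarrow> E y > 0"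
    "\<And>y x e. y \<in> Y \<Longrightarrow> x \<in> S \<Longrightarrow> proj x = y \<Longrightarrow> 0 < e \<Longrightarrow> e \<le> E y \<Longrightarrow> e \<le> e0 \<Longrightarrow> 1 \<le> h e (x - f)"
    by metis
  \<comment> \<open>The classes in \<open>Y\<close> are finitely many, so one positive size suits
    them all; the other points of \<open>S\<close> are covered by \<open>hmono\<close>.\<close>
  define e1 where "e1 = Min (insert e0 (E ` Y))"
  have e1E: "e1 \<le> E y" if "y \<in> Y" for y
    using finY that by (auto simp: e1_def)
  have e1: "0 < e1" "e1 \<le> e0" using finY E(1) e0(1) by (auto simp: e1_def)
  have "1 \<le> h e1 (x - f)" if x: "x \<in> S" for x
  proof (cases "h e0 (x - f) \<le> 1")
    case True
    then have "proj x \<in> Y" using x by (auto simp: Y_def)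
    then show ?thesis using E(2)[of "proj x" x e1] e1E e1 x by simp
  next
    case False
    then show ?thesis using hmono[of e1 e0 "x - f"] e1 e0 by simp
  qed
  then have "h e1 = \<psi>"
    unfolding h_def using e1 e0 by (intro support_max_eq_psi[OF fin ne sub]) auto
  \<comment> \<open>At \<open>r\<close> every element of the perturbed set is strictly below
    \<open>a\<close>, against \<open>h e1 = \<psi>\<close>.\<close>
  then have "a \<bullet> r \<le> h e1 r" using Ale[OF a] by simp
  moreover obtain b where "b \<in> insert (p e1) (A - {a})" "h e1 r = b \<bullet> r"
    unfolding h_def by (rule support_max_attained[OF fin ne])
  moreover have "p e1 \<bullet> r < a \<bullet> r" using r[of c] c e1(1) by (simp add: p mult_pos_neg)
  ultimately show False using r[of b] by auto
qed

end

section \<open>Facets and interiors of sublevel bodies\<close>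

text \<open>Pushing \<open>pt a\<close> slightly away from \<open>f\<close> violates the inequality
  of \<open>a\<close> and no other, so no half-space is redundant and the explicit description of
  the facets of an irredundant polyhedron applies.\<close>

lemma facet_description_if_facet_points:
  fixes f :: "real ^ 'n"
  assumes A: "finite A" and B: "B = {x. \<forall>a\<in>A. a \<bullet> (x - f) \<le> 1}" and f: "f \<in> interior B"
    and pt: "\<And>a. a \<in> A \<Longrightarrow> a \<bullet> (pt a - f) = 1"
    and pt': "\<And>a b. a \<in> A \<Longrightarrow> b \<in> A \<Longrightarrow> b \<noteq> a \<Longrightarrow> b \<bullet> (pt a - f) < 1"
  shows "facet_description f B A"
proof -
  define H where "H a = {x. a \<bullet> x \<le> 1 + a \<bullet> f}" for a
  have H: "x \<in> H a \<longleftrightarrow> a \<bullet> (x - f) \<le> 1" for x a by (auto simp: H_def inner_diff_right)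
  have BH: "B = \<Inter>(H ` A)" using B H by auto
  have "\<exists>q. q \<notin> H a \<and> (\<forall>b\<in>A - {a}. q \<in> H b)" if a: "a \<in> A" for a
  proof -
    have "\<forall>\<^sub>F t in at_right (1::real). \<forall>b\<in>A - {a}. t * (b \<bullet> (pt a - f)) < 1"
    proof (rule eventually_ball_finite)
      show "\<forall>b\<in>A - {a}. \<forall>\<^sub>F t in at_right (1::real). t * (b \<bullet> (pt a - f)) < 1"
      proof
        fix b assume b: "b \<in> A - {a}"
        have "((\<lambda>t. t * (b \<bullet> (pt a - f))) \<longlongrightarrow> 1 * (b \<bullet> (pt a - f))) (at_right 1)"
          by (intro tendsto_intros)
        moreover have "1 * (b \<bullet> (pt a - f)) < 1" using pt'[OF a] b by simp
        ultimately show "\<forall>\<^sub>F t in at_right (1::real). t * (b \<bullet> (pt a - f)) < 1"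
          by (rule order_tendstoD(2))
      qed
    qed (use A in simp)
    moreover have "\<forall>\<^sub>F t in at_right (1::real). t > 1" by (rule eventually_at_right_less)
    ultimately have "\<forall>\<^sub>F t in at_right (1::real). (\<forall>b\<in>A - {a}. t * (b \<bullet> (pt a - f)) < 1) \<and> t > 1"
      by (rule eventually_conj)
    then obtain t :: real where t: "\<forall>b\<in>A - {a}. t * (b \<bullet> (pt a - f)) < 1" "t > 1"
      using eventually_happens[of _ "at_right (1::real)"] by (auto simp: trivial_limit_at_right_real)
    show ?thesis
      using t pt[OF a] by (intro exI[of _ "f + t *\<^sub>R (pt a - f)"]) (auto simp: H less_imp_le)
  qed
  then obtain q where q: "\<And>a. a \<in> A \<Longrightarrow> q a \<notin> H a" "\<And>a b. a \<in> A \<Longrightarrow> b \<in> A - {a} \<Longrightarrow> q a \<in> H b"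
    by metis
  have inj: "inj_on H A"
  proof (rule inj_onI)
    fix a b assume "a \<in> A" "b \<in> A" "H a = H b"
    then show "a = b" using q[of a] by blast
  qed
  \<comment> \<open>The facet characterisation is indexed by half-spaces, so normals are recovered
    through the inverse of \<open>H\<close>.\<close>
  define g where "g = inv_into A H"
  have g: "g (H a) = a" if "a \<in> A" for a using inj that by (simp add: g_def)
  have aff: "affine hull B = UNIV" using f affine_hull_nonempty_interior[of B] by auto
  have facet: "C facet_of B \<longleftrightarrow> (\<exists>h. h \<in> H ` A \<and> C = B \<inter> {x. g h \<bullet> x = 1 + g h \<bullet> f})" for C
  proof (rule facet_of_polyhedron_explicit)
    show "finite (H ` A)" using A by simp
    show "B = affine hull B \<inter> \<Inter>(H ` A)" using BH aff by simp
    show "g h \<noteq> 0 \<and> h = {x. g h \<bullet> x \<le> 1 + g h \<bullet> f}" if "h \<in> H ` A" for h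
    proof -
      obtain a where a: "a \<in> A" "h = H a" using \<open>h \<in> H ` A\<close> by blast
      then have "a \<noteq> 0" using pt[OF a(1)] by auto
      moreover have "g h = a" using a g by simp
      ultimately show ?thesis using a(2) by (simp add: H_def)
    qed
    show "B \<subset> affine hull B \<inter> \<Inter>F'" if F': "F' \<subset> H ` A" for F'
    proof -
      obtain a where a: "a \<in> A" "H a \<notin> F'" using F' by blast
      have "q a \<in> h" if h: "h \<in> F'" for h
      proof -
        obtain b where "b \<in> A" "h = H b" using F' h by blast
        then show ?thesis using a h q(2)[OF a(1), of b] by blast
      qed
      then have "q a \<in> affine hull B \<inter> \<Inter>F'" using aff by blast
      moreover have "q a \<notin> B" using q(1)[OF a(1)] a(1) BH by blast
      moreover have "B \<subseteq> \<Inter>F'" using F' BH by blast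
      ultimately show ?thesis using aff by blast
    qed
  qed
  let ?F = "\<lambda>a. {x \<in> B. a \<bullet> (x - f) = 1}"
  have eq: "?F a = B \<inter> {x. a \<bullet> x = 1 + a \<bullet> f}" for a by (auto simp: inner_diff_right)
  have "{C. C facet_of B} = ?F ` A"
    unfolding facet eq using g by force
  moreover have "inj_on ?F A"
  proof (rule inj_onI)
    fix a b assume ab: "a \<in> A" "b \<in> A" "?F a = ?F b"
    have "b \<bullet> (pt a - f) \<le> 1" if "b \<in> A" for b
      using pt[OF ab(1)] pt'[OF ab(1) that] by (cases "b = a") auto
    then have "pt a \<in> ?F a" using pt[OF ab(1)] B by auto
    then have "pt a \<in> ?F b" by (simp only: ab(3))
    then show "a = b" using pt'[OF ab(1,2)] by fastforce
  qed
  ultimately show ?thesis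
    unfolding facet_description_def bij_betw_def using A B by simp
qed

lemma facet_normals_eqI:
  assumes "f \<in> interior B" "facet_description f B A"
  shows "facet_normals f B = A"
  unfolding facet_normals_def using assms facet_description_unique by (intro the_equality) auto

text \<open>For the interior: moving outwards from \<open>x\<close> along \<open>x - f\<close>
  multiplies \<open>h\<close> by \<open>1 + t\<close>; if the result is still at most 1, the value
  at \<open>x\<close> was strictly below 1.\<close>

lemma sublinear_sublevel:
  fixes h :: "'a::euclidean_space \<Rightarrow> real"
  assumes h: "sublinear h"
  shows "convex {x. h (x - f) \<le> 1}" and "interior {x. h (x - f) \<le> 1} = {x. h (x - f) < 1}"
proof -
  let ?B = "{x. h (x - f) \<le> 1}"
  show "convex ?B"
  proof (rule convexI)
    fix x z and u v :: real
    assume *: "x \<in> ?B" "z \<in> ?B" "u \<ge> 0" "v \<ge> 0" "u + v = 1"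
    have "u *\<^sub>R x + v *\<^sub>R z - f = u *\<^sub>R (x - f) + v *\<^sub>R (z - f)"
      using *(5) by (simp add: algebra_simps flip: scaleR_add_left)
    then have "h (u *\<^sub>R x + v *\<^sub>R z - f) \<le> u * h (x - f) + v * h (z - f)"
      using sublinear_add[OF h, of "u *\<^sub>R (x - f)" "v *\<^sub>R (z - f)"] sublinear_scale[OF h] * by simp
    also have "\<dots> \<le> 1" using * convex_bound_le[of "h (x - f)" 1 "h (z - f)" u v] by simp
    finally show "u *\<^sub>R x + v *\<^sub>R z \<in> ?B" by simp
  qed
  show "interior ?B = {x. h (x - f) < 1}"
  proof
    show "{x. h (x - f) < 1} \<subseteq> interior ?B"
    proof (rule interior_maximal)
      have "continuous_on UNIV (\<lambda>x. h (x - f))"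
        by (intro continuous_on_compose2[OF sublinear_continuous[OF h, of UNIV]] continuous_intros) auto
      then show "open {x. h (x - f) < 1}" by (intro open_Collect_less continuous_intros)
    qed auto
    show "interior ?B \<subseteq> {x. h (x - f) < 1}"
    proof
      fix x assume "x \<in> interior ?B"
      then obtain e where e: "e > 0" "cball x e \<subseteq> ?B" unfolding mem_interior_cball by blast
      show "x \<in> {x. h (x - f) < 1}"
      proof (cases "x = f")
        case False
        define t where "t = e / norm (x - f)"
        have t: "t > 0" using e False by (simp add: t_def)
        have "x + t *\<^sub>R (x - f) \<in> cball x e" using e(1) False by (simp add: t_def dist_norm)
        then have "h (x + t *\<^sub>R (x - f) - f) \<le> 1" using e(2) by blast
        moreover have "x + t *\<^sub>R (x - f) - f = (1 + t) *\<^sub>R (x - f)" by (simp add: algebra_simps)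
        ultimately have "(1 + t) * h (x - f) \<le> 1" using sublinear_scale[OF h, of "1 + t"] t by simp
        then have "h (x - f) \<le> 1 / (1 + t)" using t by (simp add: field_simps)
        also have "\<dots> < 1" using t by simp
        finally show ?thesis by simp
      qed (simp add: sublinear_0[OF h])
    qed
  qed
qed

section \<open>From minimal valid functions to maximal S-free sets\<close>

context minimal_sublinear
begin

text \<open>If a larger convex set had a point \<open>y\<close> beyond the facet of
  \<open>a\<close>, the facet point \<open>x\<close> of \<open>a\<close> would lie between
  \<open>y\<close> and an interior point of \<open>B\<close>, hence in the interior of the larger
  set.\<close>

lemma maximal_S_free_sublevel:
  assumes f: "f \<in> convex hull S"
  defines "B \<equiv> {x. \<psi> (x - f) \<le> 1}"
  shows "maximal_S_free_convex S B" "f \<in> interior B" "psi f B = \<psi>"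
proof -
  obtain A where A: "finite A" "A \<noteq> {}" "support_max A = \<psi>"
    and least: "\<And>A'. finite A' \<Longrightarrow> A' \<noteq> {} \<Longrightarrow> support_max A' = \<psi> \<Longrightarrow> card A \<le> card A'"
    using ex_has_least_nat[of "\<lambda>A. finite A \<and> A \<noteq> {} \<and> support_max A = \<psi>" _ card] polyhedral by metis
  have "\<forall>a\<in>A. \<exists>x. x \<in> S \<and> a \<bullet> (x - f) = 1 \<and> (\<forall>b\<in>A - {a}. b \<bullet> (x - f) < 1)"
    using facet_point[OF A(1,3) _ least f] by blast
  then obtain pt where pt: "\<And>a. a \<in> A \<Longrightarrow> pt a \<in> S" "\<And>a. a \<in> A \<Longrightarrow> a \<bullet> (pt a - f) = 1"
    "\<And>a b. a \<in> A \<Longrightarrow> b \<in> A \<Longrightarrow> b \<noteq> a \<Longrightarrow> b \<bullet> (pt a - f) < 1" by (metis Diff_iff singletonD)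
  have BA: "B = {x. \<forall>a\<in>A. a \<bullet> (x - f) \<le> 1}"
    unfolding B_def A(3)[symmetric] support_max_le_iff[OF A(1,2)] ..
  have int: "interior B = {x. \<psi> (x - f) < 1}" and conv: "convex B"
    unfolding B_def using sublinear_sublevel[OF sublinear] by auto
  show fB: "f \<in> interior B" using int sublinear_0[OF sublinear] by simp
  have "facet_description f B A"
    by (rule facet_description_if_facet_points[OF A(1) BA fB pt(2,3)])
  then have "facet_normals f B = A" by (rule facet_normals_eqI[OF fB])
  then show "psi f B = \<psi>" using A(3) by (auto simp: psi_def support_max_def)
  have free: "S_free_convex S B"
    using conv int ge1 by (force simp: S_free_convex_def)
  show "maximal_S_free_convex S B"
    unfolding maximal_S_free_convex_def
  proof (intro conjI free notI)
    assume "\<exists>C. S_free_convex S C \<and> B \<subset> C"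
    then obtain C where C: "convex C" "interior C \<inter> S = {}" "B \<subset> C" by (auto simp: S_free_convex_def)
    then obtain y where y: "y \<in> C" "y \<notin> B" by blast
    then obtain a where a: "a \<in> A" "a \<bullet> (y - f) > 1" using BA by (auto simp: not_le)
    define x where "x = pt a"
    have x: "x \<in> S" "a \<bullet> (x - f) = 1" "\<And>b. b \<in> A \<Longrightarrow> b \<noteq> a \<Longrightarrow> b \<bullet> (x - f) < 1"
      using pt a by (simp_all add: x_def)
    \<comment> \<open>Stepping from \<open>x\<close> away from \<open>y\<close> lowers
      \<open>a\<close> below 1, since \<open>a\<close> exceeds 1 at \<open>y\<close>; the other
      inequalities are strict at \<open>x\<close> and survive small \<open>t\<close>.\<close>
    have "\<forall>\<^sub>F t in at_right (0::real). \<forall>b\<in>A. b \<bullet> (x + t *\<^sub>R (x - y) - f) < 1"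
    proof (rule eventually_ball_finite[OF A(1)], rule ballI)
      fix b assume b: "b \<in> A"
      have eq: "b \<bullet> (x + t *\<^sub>R (x - y) - f) = b \<bullet> (x - f) + t * (b \<bullet> (x - f) - b \<bullet> (y - f))" for t
        by (simp add: algebra_simps)
      show "\<forall>\<^sub>F t in at_right (0::real). b \<bullet> (x + t *\<^sub>R (x - y) - f) < 1"
      proof (cases "b = a")
        case True
        have "\<forall>\<^sub>F t in at_right (0::real). t > 0" by (rule eventually_at_right_less)
        then show ?thesis
          unfolding eq by (rule eventually_mono) (use True a x(2) in \<open>simp add: mult_pos_neg\<close>)
      next
        case False
        have "((\<lambda>t. b \<bullet> (x - f) + t * (b \<bullet> (x - f) - b \<bullet> (y - f))) \<longlongrightarrow>
            b \<bullet> (x - f) + 0 * (b \<bullet> (x - f) - b \<bullet> (y - f))) (at_right 0)"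
          by (intro tendsto_intros)
        then show ?thesis unfolding eq using x(3)[OF b False] by (intro order_tendstoD(2)) auto
      qed
    qed
    moreover have "\<forall>\<^sub>F t in at_right (0::real). t > 0" by (rule eventually_at_right_less)
    ultimately have "\<forall>\<^sub>F t in at_right (0::real). (\<forall>b\<in>A. b \<bullet> (x + t *\<^sub>R (x - y) - f) < 1) \<and> t > 0"
      by (rule eventually_conj)
    then obtain t :: real where t: "\<forall>b\<in>A. b \<bullet> (x + t *\<^sub>R (x - y) - f) < 1" "t > 0"
      using eventually_happens[of _ "at_right (0::real)"] by (auto simp: trivial_limit_at_right_real)
    define w where "w = x + t *\<^sub>R (x - y)"
    obtain b where "b \<in> A" "\<psi> (w - f) = b \<bullet> (w - f)"
      using support_max_attained[OF A(1,2), of "w - f"] A(3) by metis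
    then have "w \<in> interior B" using t(1) int by (simp add: w_def)
    then have "w \<in> interior C" using C(3) interior_mono[of B C] by blast
    then have "open_segment w y \<subseteq> interior C"
      using C(1) y(1) closure_subset by (intro in_interior_closure_convex_segment) auto
    moreover have "x \<in> open_segment w y"
      unfolding in_segment
    proof (intro conjI exI[of _ "t / (1 + t)"])
      have xy: "x \<noteq> y" using x(2) a(2) by auto
      have "w - y = (1 + t) *\<^sub>R (x - y)" by (simp add: w_def algebra_simps)
      then show "w \<noteq> y" using xy t(2) by auto
      show "0 < t / (1 + t)" "t / (1 + t) < 1" using t(2) by simp_all
      have "1 - t / (1 + t) = 1 / (1 + t)" using t(2) by (simp add: field_simps)
      then have "(1 - t / (1 + t)) *\<^sub>R w + (t / (1 + t)) *\<^sub>R y = (1 / (1 + t)) *\<^sub>R (w + t *\<^sub>R y)"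
        by (simp add: scaleR_add_right)
      also have "w + t *\<^sub>R y = (1 + t) *\<^sub>R x" by (simp add: w_def algebra_simps)
      also have "(1 / (1 + t)) *\<^sub>R \<dots> = x" using t(2) by simp
      finally show "x = (1 - t / (1 + t)) *\<^sub>R w + (t / (1 + t)) *\<^sub>R y" ..
    qed
    ultimately show False using C(2) x(1) by blast
  qed
qed

end

section \<open>The correspondence with maximal S-free convex sets\<close>

text \<open>The witness is the Minkowski gauge of \<open>B\<close> about \<open>f\<close>. Were it
  below 1 at \<open>x - f\<close>, then \<open>x\<close> would lie strictly between \<open>f\<close>
  and a point of \<open>B\<close>, hence in the interior of \<open>B\<close>, which misses
  \<open>S\<close>.\<close>

lemma gauge_sublinear_valid:
  fixes S B :: "'a::euclidean_space set"
  assumes B: "convex B" "f \<in> interior B" "interior B \<inter> S = {}"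
  shows "\<exists>g. sublinear_valid f S g \<and> (\<forall>x\<in>B. g (x - f) \<le> 1)"
proof -
  define T where "T r = {t. t > 0 \<and> f + (1 / t) *\<^sub>R r \<in> B}" for r
  define g where "g r = Inf (T r)" for r
  obtain \<delta> where \<delta>: "\<delta> > 0" "cball f \<delta> \<subseteq> B" using B(2) unfolding mem_interior_cball by blast
  have ne: "T r \<noteq> {}" for r
  proof -
    \<comment> \<open>Scales \<open>r\<close> down to length at most \<delta>; the
      \<open>+ 1\<close> keeps \<open>t\<close> positive at \<open>r = 0\<close>.\<close>
    define t where "t = (norm r + 1) / \<delta>"
    have n1: "norm r + 1 > 0" by (simp add: add_nonneg_pos)
    have t: "t > 0" using \<delta> n1 by (simp add: t_def)
    have "norm r \<le> \<delta> * t" using \<delta>(1) by (simp add: t_def)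
    then have "norm ((1 / t) *\<^sub>R r) \<le> \<delta>" using t by (simp add: field_simps)
    then have "f + (1 / t) *\<^sub>R r \<in> B" using \<delta>(2) by (auto simp: dist_norm)
    then show ?thesis using t by (auto simp: T_def)
  qed
  have bdd: "bdd_below (T r)" for r by (rule bdd_belowI[of _ 0]) (simp add: T_def)
  have lower: "g r \<le> t" if "t \<in> T r" for r t unfolding g_def using that bdd by (rule cInf_lower)
  have greatest: "m \<le> g r" if "\<And>t. t \<in> T r \<Longrightarrow> m \<le> t" for m r
    unfolding g_def using ne that by (rule cInf_greatest)
  have Tadd: "t + u \<in> T (r + s)" if "t \<in> T r" "u \<in> T s" for t u r s
  proof -
    have tu: "t > 0" "u > 0" using that by (auto simp: T_def)
    \<comment> \<open>Convex weights proportional to \<open>t\<close> and \<open>u\<close> produce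
      the point for \<open>r + s\<close> at scale \<open>t + u\<close>.\<close>
    have "(t / (t + u)) *\<^sub>R (f + (1 / t) *\<^sub>R r) + (u / (t + u)) *\<^sub>R (f + (1 / u) *\<^sub>R s) \<in> B"
      using that tu by (intro convexD[OF B(1)]) (auto simp: T_def simp flip: add_divide_distrib)
    also have "(t / (t + u)) *\<^sub>R (f + (1 / t) *\<^sub>R r) + (u / (t + u)) *\<^sub>R (f + (1 / u) *\<^sub>R s)
      = (t / (t + u) + u / (t + u)) *\<^sub>R f + (1 / (t + u)) *\<^sub>R (r + s)"
      using tu by (simp add: scaleR_add_right scaleR_add_left)
    also have "t / (t + u) + u / (t + u) = 1" using tu by (simp flip: add_divide_distrib)
    finally show ?thesis using tu by (simp add: T_def)
  qed
  have "sublinear g"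
    unfolding sublinear_def
  proof (intro conjI allI impI)
    fix r s
    have "g (r + s) - g s \<le> g r"
    proof (rule greatest)
      fix t assume t: "t \<in> T r"
      have "g (r + s) - t \<le> g s"
      proof (rule greatest)
        fix u assume "u \<in> T s"
        then show "g (r + s) - t \<le> u" using lower[OF Tadd[OF t, of u s]] by linarith
      qed
      then show "g (r + s) - g s \<le> t" by simp
    qed
    then show "g (r + s) \<le> g r + g s" by simp
  next
    fix c :: real and r assume c: "c > 0"
    have "g (c *\<^sub>R r) / c \<le> g r"
    proof (rule greatest)
      fix t assume "t \<in> T r"
      then have "c * t \<in> T (c *\<^sub>R r)" using c by (simp add: T_def)
      then show "g (c *\<^sub>R r) / c \<le> t" using lower c by (fastforce simp: field_simps)
    qed
    then show "g (c *\<^sub>R r) \<le> c * g r" using c by (simp add: field_simps)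
  qed
  moreover have "1 \<le> g (x - f)" if x: "x \<in> S" for x
  proof (rule ccontr)
    assume "\<not> 1 \<le> g (x - f)"
    then obtain t where t: "t \<in> T (x - f)" "t < 1"
      using cInf_lessD[OF ne] unfolding g_def by (metis not_le)
    define q where "q = f + (1 / t) *\<^sub>R (x - f)"
    have q: "q \<in> B" "t > 0" using t by (auto simp: T_def q_def)
    have xf: "x \<noteq> f" using x B by blast
    have "x \<in> open_segment f q"
      unfolding in_segment
    proof (intro conjI exI[of _ t])
      show "f \<noteq> q" using xf q(2) by (simp add: q_def)
      show "x = (1 - t) *\<^sub>R f + t *\<^sub>R q" using q(2) by (simp add: q_def algebra_simps)
    qed (use q t in auto)
    moreover have "open_segment f q \<subseteq> interior B"
      using B(1,2) q(1) closure_subset by (intro in_interior_closure_convex_segment) auto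
    ultimately show False using x B(3) by blast
  qed
  moreover have "g (x - f) \<le> 1" if "x \<in> B" for x
    using that by (intro lower) (simp add: T_def)
  ultimately show ?thesis unfolding sublinear_valid_def by blast
qed

section \<open>Clearing denominators\<close>

lemma rational_vector_multiple:
  fixes a :: "real ^ 'n"
  assumes "\<forall>i. a $ i \<in> \<rat>"
  shows "\<exists>k::nat. k > 0 \<and> of_nat k *\<^sub>R a \<in> integer_points"
proof -
  have "\<exists>n::nat. n > 0 \<and> of_nat n * a $ i \<in> \<int>" for i
  proof -
    have "a $ i \<in> \<rat>" using assms by blast
    then obtain m :: int and n :: nat where "n \<noteq> 0" "a $ i = of_int m / of_nat n"
      unfolding Rats_eq_int_div_nat by blast
    then show ?thesis by (intro exI[of _ n]) simp
  qed
  then obtain n :: "'n \<Rightarrow> nat" where n: "\<And>i. n i > 0" "\<And>i. of_nat (n i) * a $ i \<in> \<int>" by metis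
  define k where "k = (\<Prod>i\<in>UNIV. n i)"
  have "of_nat k * a $ i \<in> \<int>" for i
  proof -
    have "k = n i * (\<Prod>j\<in>UNIV - {i}. n j)" unfolding k_def by (rule prod.remove) auto
    then have "of_nat k * a $ i = of_nat (\<Prod>j\<in>UNIV - {i}. n j) * (of_nat (n i) * a $ i)" by simp
    also have "\<dots> \<in> \<int>" by (intro Ints_mult Ints_of_nat n(2))
    finally show ?thesis .
  qed
  moreover have "k > 0" using n(1) by (simp add: k_def prod_pos)
  ultimately show ?thesis by (auto simp: integer_points_def)
qed

text \<open>Each row is scaled, together with its right-hand side, by a positive integer of its own,
  which leaves the solution set unchanged.\<close>

lemma polyhedral_lattice_set_if_rational_polyhedron:
  assumes P: "rational_polyhedron P" and ne: "P \<inter> integer_points \<noteq> {}"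
  shows "\<exists>I. polyhedral_lattice_set I (P \<inter> integer_points)"
proof -
  obtain I where I: "finite I" "\<forall>(a, b)\<in>I. (\<forall>i. a $ i \<in> \<rat>) \<and> b \<in> \<rat>" "P = {x. \<forall>(a, b)\<in>I. a \<bullet> x \<le> b}"
    using P unfolding rational_polyhedron_def by blast
  have "\<forall>c\<in>I. \<exists>k::nat. k > 0 \<and> of_nat k *\<^sub>R fst c \<in> integer_points"
    using I(2) by (auto intro!: rational_vector_multiple)
  then obtain k :: "(real ^ 'a) \<times> real \<Rightarrow> nat"
    where k: "\<And>c. c \<in> I \<Longrightarrow> k c > 0" "\<And>c. c \<in> I \<Longrightarrow> of_nat (k c) *\<^sub>R fst c \<in> integer_points"
    by metis
  define J where "J = (\<lambda>c. (of_nat (k c) *\<^sub>R fst c, of_nat (k c) * snd c)) ` I"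
  have "(\<forall>(a, b)\<in>J. a \<bullet> x \<le> b) \<longleftrightarrow> (\<forall>(a, b)\<in>I. a \<bullet> x \<le> b)" for x
    unfolding J_def using k(1) by (force simp: split_beta)
  then have "polyhedral_lattice_set J (P \<inter> integer_points)"
    using I k(2) ne by unfold_locales (auto simp: J_def)
  then show ?thesis by blast
qed

theorem theorem6:
  fixes S P :: "(real ^ 'n) set" and f :: "real ^ 'n"
  assumes "rational_polyhedron P"
    and "S = P \<inter> integer_points"
    and "full_dimensional S"
    and "f \<in> convex hull S - integer_points"
  shows "(\<forall>\<psi>. minimal_valid_fun f S \<psi> \<longrightarrow>
            (\<exists>B. maximal_S_free_convex S B \<and> f \<in> interior B \<and> dominates (psi f B) \<psi>)) \<and>
         (\<forall>B. maximal_S_free_convex S B \<and> f \<in> interior B \<longrightarrow>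
            minimal_valid_fun f S (psi f B))"
proof -
  have f: "f \<in> convex hull S" using assms(4) by blast
  then have ne: "S \<noteq> {}" by auto
  then obtain I where I: "polyhedral_lattice_set I S"
    using polyhedral_lattice_set_if_rational_polyhedron[OF assms(1)] assms(2) by blast
  have body: "maximal_S_free_convex S {x. \<psi> (x - f) \<le> 1}" "f \<in> interior {x. \<psi> (x - f) \<le> 1}"
    "psi f {x. \<psi> (x - f) \<le> 1} = \<psi>" if "minimal_valid_fun f S \<psi>" for \<psi>
  proof -
    interpret polyhedral_lattice_set I S by (rule I)
    interpret minimal_sublinear I S f \<psi>
      using minimal_valid_fun_sublinear[OF ne that] minimal_valid_funD[OF that] by unfold_locales auto
    show "maximal_S_free_convex S {x. \<psi> (x - f) \<le> 1}" "f \<in> interior {x. \<psi> (x - f) \<le> 1}"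
      "psi f {x. \<psi> (x - f) \<le> 1} = \<psi>"
      using maximal_S_free_sublevel[OF f] by simp_all
  qed
  show ?thesis
  proof (intro conjI allI impI)
    fix \<psi> assume \<psi>: "minimal_valid_fun f S \<psi>"
    \<comment> \<open>For the body of \<psi> the function \<open>psi f B\<close> equals \<psi>, so
      reflexivity is all that domination asks.\<close>
    have "dominates \<psi> \<psi>" by (simp add: dominates_def)
    then show "\<exists>B. maximal_S_free_convex S B \<and> f \<in> interior B \<and> dominates (psi f B) \<psi>"
      using body[OF \<psi>] by metis
  next
    fix B assume B: "maximal_S_free_convex S B \<and> f \<in> interior B"
    then have "convex B" "interior B \<inter> S = {}"
      by (auto simp: maximal_S_free_convex_def S_free_convex_def)
    then obtain g where g: "sublinear_valid f S g" "\<And>x. x \<in> B \<Longrightarrow> g (x - f) \<le> 1"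
      using gauge_sublinear_valid[of B f S] B by blast
    obtain \<psi> where \<psi>: "minimal_valid_fun f S \<psi>" "\<And>r. \<psi> r \<le> g r"
      using minimal_valid_fun_below[OF ne g(1)] by blast
    \<comment> \<open>The body of a minimal valid function below the gauge is \<open>S\<close>-free
      and contains \<open>B\<close>; maximality of \<open>B\<close> makes them equal, so
      \<open>psi f B\<close> is that minimal function.\<close>
    have "B \<subseteq> {x. \<psi> (x - f) \<le> 1}" using g(2) \<psi>(2) order_trans by blast
    then have "B = {x. \<psi> (x - f) \<le> 1}"
      using B body(1)[OF \<psi>(1)] unfolding maximal_S_free_convex_def by blast
    then show "minimal_valid_fun f S (psi f B)" using body(3)[OF \<psi>(1)] \<psi>(1) by simp
  qed
qed

end
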